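(* Let $k,d\ge 1$ be integers and let $V\subset\mathbb{R}^p$ be a generally $k$-neighborly $d$-dimensional algebraic variety. Then $p\ge 2k+d-1$.
   Context: An (affine real) algebraic variety is a set $V=V(\mathbb{C})\cap\mathbb{R}^p$, where $V(\mathbb{C})\subset\mathbb{C}^p$ is the common zero set of finitely many polynomials in $\mathbb{R}[x_1,\dots,x_p]$; the varieties considered contain smooth real points and $V(\mathbb{C})$ is the smallest complex variety containing $V$. The dimension of $V$ is the dimension of $V(\mathbb{C})$. $V$ is irreducible if it is not the union of two proper algebraic subvarieties. A smooth point is a point where the Jacobian matrix of generators of the ideal of $V(\mathbb{C})$ has maximal rank; $V_{\mathrm{sm}}$ denotes the set of smooth points of $V$. A polytope is $k$-neighborly if any set of $k$ or fewer of its vertices forms a face (is the vertex set of a face, the polytope itself being counted as a face); a finite point set is $k$-neighborly if it is the vertex set of a $k$-neighborly polytope. Let $V\subset\mathbb{R}^p$ be an irreducible real algebraic variety with a smooth real point. For each $n$ let $G_n\subset V_{\mathrm{sm}}^n$ consist of all configurations of $n$ points on $V_{\mathrm{sm}}$ which are $k$-neighborly. $V$ is generally $k$-neighborly if $G_n$ contains a set that is open and dense in $V_{\mathrm{sm}}^n$ (Euclidean subspace topology) for all $n$. (In particular, a generally $k$-neighborly variety is irreducible and has a smooth real point.) *)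

theory Defs
  imports "HOL-Analysis.Analysis" "HOL-Library.Poly_Mapping" "HOL-Library.Extended_Nat"
begin

text \<open>Polynomials over \<open>'a\<close> in the variables indexed by the finite type \<open>'p\<close>: finitely
  supported maps from exponent vectors to coefficients, with the library's convolution product.\<close>

type_synonym ('a, 'p) mpoly = "('p \<Rightarrow>\<^sub>0 nat) \<Rightarrow>\<^sub>0 'a"

definition mpoly_eval :: "('a::comm_ring_1, 'p::finite) mpoly \<Rightarrow> 'a ^ 'p \<Rightarrow> 'a" where
  "mpoly_eval f z =
     (\<Sum>m\<in>Poly_Mapping.keys f. Poly_Mapping.lookup f m *
        (\<Prod>i\<in>UNIV. (z $ i) ^ Poly_Mapping.lookup m i))"

definition mpoly_pderiv :: "'p::finite \<Rightarrow> ('a::comm_ring_1, 'p) mpoly \<Rightarrow> ('a, 'p) mpoly" where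
  "mpoly_pderiv i f =
     (\<Sum>m\<in>Poly_Mapping.keys f. Poly_Mapping.single (m - Poly_Mapping.single i 1)
        (of_nat (Poly_Mapping.lookup m i) * Poly_Mapping.lookup f m))"

definition complex_mpoly :: "(real, 'p::finite) mpoly \<Rightarrow> (complex, 'p) mpoly" where
  "complex_mpoly f = Poly_Mapping.map complex_of_real f"

definition complex_vec :: "real ^ 'p::finite \<Rightarrow> complex ^ 'p" where
  "complex_vec x = (\<chi> i. complex_of_real (x $ i))"

definition zero_set :: "('a::comm_ring_1, 'p::finite) mpoly set \<Rightarrow> ('a ^ 'p) set" where
  "zero_set F = {z. \<forall>f\<in>F. mpoly_eval f z = 0}"

definition algebraic_set :: "('a::comm_ring_1 ^ 'p::finite) set \<Rightarrow> bool" where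
  "algebraic_set S \<longleftrightarrow> (\<exists>F. finite F \<and> S = zero_set F)"

definition irreducible_set :: "('a::comm_ring_1 ^ 'p::finite) set \<Rightarrow> bool" where
  "irreducible_set S \<longleftrightarrow> algebraic_set S \<and> S \<noteq> {} \<and>
     \<not> (\<exists>A B. algebraic_set A \<and> algebraic_set B \<and> A \<subset> S \<and> B \<subset> S \<and> S = A \<union> B)"

text \<open>The Krull dimension of an algebraic set: the supremum of the lengths of strictly
  increasing chains of irreducible algebraic subsets.\<close>

definition alg_dim :: "('a::comm_ring_1 ^ 'p::finite) set \<Rightarrow> enat" where
  "alg_dim W = Sup {enat n | n. \<exists>Z :: nat \<Rightarrow> ('a ^ 'p) set.
     (\<forall>i\<le>n. irreducible_set (Z i) \<and> Z i \<subseteq> W) \<and> (\<forall>i<n. Z i \<subset> Z (Suc i))}"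

text \<open>The smallest complex algebraic set containing the real point set \<open>V\<close>.\<close>

definition complexification :: "(real ^ 'p::finite) set \<Rightarrow> (complex ^ 'p) set" where
  "complexification V = \<Inter>{W. algebraic_set W \<and> complex_vec ` V \<subseteq> W}"

definition real_variety :: "(real ^ 'p::finite) set \<Rightarrow> bool" where
  "real_variety V \<longleftrightarrow>
     (\<exists>F :: (real, 'p) mpoly set. finite F \<and> complexification V = zero_set (complex_mpoly ` F)) \<and>
     V = {x. complex_vec x \<in> complexification V}"

definition variety_dim :: "(real ^ 'p::finite) set \<Rightarrow> enat" where
  "variety_dim V = alg_dim (complexification V)"

definition vanishing_ideal :: "('a::comm_ring_1 ^ 'p::finite) set \<Rightarrow> ('a, 'p) mpoly set" where
  "vanishing_ideal W = {f. \<forall>z\<in>W. mpoly_eval f z = 0}"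

definition generates_ideal ::
    "('a::comm_ring_1, 'p::finite) mpoly set \<Rightarrow> ('a, 'p) mpoly set \<Rightarrow> bool" where
  "generates_ideal G I \<longleftrightarrow> finite G \<and> I = {(\<Sum>g\<in>G. h g * g) | h. True}"

text \<open>The rank of the Jacobian matrix of \<open>G\<close> at \<open>z\<close>, as the dimension of its row space.  The rows
  are indexed by the set \<open>G\<close> rather than by a type, so \<^const>\<open>rank\<close> does not apply directly.\<close>

definition jacobian_rank :: "('a::field, 'p::finite) mpoly set \<Rightarrow> 'a ^ 'p \<Rightarrow> nat" where
  "jacobian_rank G z = vec.dim ((\<lambda>g. \<chi> i. mpoly_eval (mpoly_pderiv i g) z) ` G)"

text \<open>The maximum is taken over the complex variety.  The rank at its points does not depend on
  the choice of the generators.\<close>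

definition smooth_points :: "(real ^ 'p::finite) set \<Rightarrow> (real ^ 'p) set" where
  "smooth_points V = {x\<in>V. \<exists>G. generates_ideal G (vanishing_ideal (complexification V)) \<and>
     (\<forall>z\<in>complexification V. jacobian_rank G z \<le> jacobian_rank G (complex_vec x))}"

definition vertices :: "'a::real_vector set \<Rightarrow> 'a set" where
  "vertices P = {v. v extreme_point_of P}"

definition neighborly_polytope :: "nat \<Rightarrow> 'a::euclidean_space set \<Rightarrow> bool" where
  "neighborly_polytope k P \<longleftrightarrow> polytope P \<and>
     (\<forall>S\<subseteq>vertices P. card S \<le> k \<longrightarrow> (\<exists>F. F face_of P \<and> vertices F = S))"

definition neighborly_set :: "nat \<Rightarrow> 'a::euclidean_space set \<Rightarrow> bool" where
  "neighborly_set k X \<longleftrightarrow> (\<exists>P. neighborly_polytope k P \<and> X = vertices P)"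

text \<open>The \<open>n\<close>-fold power of a subspace of Euclidean space; its points are the functions in
  \<open>{..<n} \<rightarrow>\<^sub>E S\<close>.\<close>

definition power_space :: "nat \<Rightarrow> 'a::topological_space set \<Rightarrow> (nat \<Rightarrow> 'a) topology" where
  "power_space n S = product_topology (\<lambda>_. top_of_set S) {..<n}"

definition neighborly_configs :: "nat \<Rightarrow> nat \<Rightarrow> (real ^ 'p::finite) set \<Rightarrow> (nat \<Rightarrow> real ^ 'p) set" where
  "neighborly_configs k n V =
     {x \<in> {..<n} \<rightarrow>\<^sub>E smooth_points V. neighborly_set k (x ` {..<n})}"

definition generally_neighborly :: "nat \<Rightarrow> (real ^ 'p::finite) set \<Rightarrow> bool" where
  "generally_neighborly k V \<longleftrightarrow>
     real_variety V \<and> irreducible_set V \<and> smooth_points V \<noteq> {} \<and>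
     (\<forall>n. \<exists>U \<subseteq> neighborly_configs k n V.
        openin (power_space n (smooth_points V)) U \<and>
        power_space n (smooth_points V) closure_of U = topspace (power_space n (smooth_points V)))"

end

theory Submission imports Defs begin

text \<open>
  Any \<open>k\<close> points of a relatively open piece \<open>M\<close> of the smooth locus lie on a supporting hyperplane of
  \<open>M\<close>, as a limit of supporting hyperplanes of neighborly polytopes with vertices in \<open>M\<close>; its normal
  can be taken in the direction space of the affine hull of \<open>M\<close>, and the hyperplane contains the
  tangent spaces at the \<open>k\<close> points. Choosing the points one after another, the affine span of the
  tangent spaces grows by at least two dimensions in each step: otherwise the projection of \<open>M\<close> from
  the span reached so far has velocities parallel to the position, so \<open>M\<close> lies in the span of its
  directions with one more point, contradicting the supporting hyperplane (Palatini's argument).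
  Hence \<open>d + 2 (k - 1) \<le> p - 1\<close>.

  The pieces \<open>M\<close> come from Whitney's argument: near a smooth point, the zero set of \<open>r\<close> equations with
  independent gradients is contained in \<open>V\<close>, because along curves in it the ideal of \<open>V\<close> is stable
  under differentiation. That the Krull dimension is at most \<open>p - r\<close> follows by counting monomials: a
  chain of length \<open>n\<close> yields \<open>n\<close> polynomials algebraically independent on \<open>V\<close>, which together with
  the \<open>r\<close> equations are algebraically independent on the whole space.
\<close>

subsection \<open>Evaluation of polynomials\<close>

text \<open>A hyperplane containing all of \<open>V\<close> supports every piece of \<open>V\<close>
  and carries no information. This is why the normal is sought as a unit vector in the direction
  space of the piece: both conditions are closed, so they survive the limit, and such a vector is
  not constant on the piece. The chart is used only as a differentiable map, for which a smaller
  piece might span less; the piece is therefore fixed as one whose direction space cannot shrink any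
  further. The numbers: the tangent space at the first point contributes at least
  \<open>p - r\<close>, each of the other \<open>k - 1\<close> points at least two, and the total
  lies in the hyperplane orthogonal to the normal, of dimension \<open>p - 1\<close>. An inequality
  \<open>d \<le> p - r\<close> is enough, since larger tangent spaces only strengthen the bound.
  Smoothness is defined by ranks at complex points, whereas hyperplanes and curves are real; the
  link is the dimension of the space of gradients of real polynomials vanishing on
  \<open>V\<close>.\<close>

definition monom_eval :: "('p::finite \<Rightarrow>\<^sub>0 nat) \<Rightarrow> 'a::comm_ring_1 ^ 'p \<Rightarrow> 'a" where
  "monom_eval m z = (\<Prod>i\<in>UNIV. (z $ i) ^ Poly_Mapping.lookup m i)"

lemma mpoly_eval_eq_sum:
  assumes "finite A" "Poly_Mapping.keys f \<subseteq> A"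
  shows "mpoly_eval f z = (\<Sum>m\<in>A. Poly_Mapping.lookup f m * monom_eval m z)"
  unfolding mpoly_eval_def monom_eval_def using assms
  by (intro sum.mono_neutral_left) (auto simp: in_keys_iff)

lemma monom_eval_add: "monom_eval (m + n) z = monom_eval m z * monom_eval n z"
  by (simp add: monom_eval_def lookup_add power_add prod.distrib)

lemma mpoly_eval_single: "mpoly_eval (Poly_Mapping.single m a) z = a * monom_eval m z"
  by (subst mpoly_eval_eq_sum[of "{m}"]) (auto simp: keys_single)

lemma mpoly_eval_zero [simp]: "mpoly_eval 0 z = 0"
  by (simp add: mpoly_eval_def)

lemma mpoly_eval_add [simp]: "mpoly_eval (f + g) z = mpoly_eval f z + mpoly_eval g z"
proof -
  let ?A = "Poly_Mapping.keys f \<union> Poly_Mapping.keys g"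
  have "mpoly_eval (f + g) z = (\<Sum>m\<in>?A. Poly_Mapping.lookup (f + g) m * monom_eval m z)"
    using keys_add[of f g] by (intro mpoly_eval_eq_sum) auto
  also have "\<dots> = mpoly_eval f z + mpoly_eval g z"
    by (simp add: mpoly_eval_eq_sum[of ?A f] mpoly_eval_eq_sum[of ?A g] lookup_add
        distrib_right sum.distrib)
  finally show ?thesis .
qed

lemma mpoly_eval_sum [simp]: "mpoly_eval (sum f A) z = (\<Sum>a\<in>A. mpoly_eval (f a) z)"
  by (induction A rule: infinite_finite_induct) auto

lemma poly_mapping_eq_sum_single:
  "f = (\<Sum>m\<in>Poly_Mapping.keys f. Poly_Mapping.single m (Poly_Mapping.lookup f m))"
  by (rule poly_mapping_eqI)
    (auto simp: lookup_sum lookup_single when_def sum.delta in_keys_iff)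

lemma mpoly_eval_mult [simp]: "mpoly_eval (f * g) z = mpoly_eval f z * mpoly_eval g z"
proof -
  let ?s = "\<lambda>f. \<Sum>m\<in>Poly_Mapping.keys f. Poly_Mapping.single m (Poly_Mapping.lookup f m)"
  have "mpoly_eval (?s f * ?s g) z = mpoly_eval (?s f) z * mpoly_eval (?s g) z"
    by (simp add: sum_product mult_single mpoly_eval_single monom_eval_add mult_ac)
  then show ?thesis
    by (simp flip: poly_mapping_eq_sum_single)
qed

abbreviation mpoly_const :: "'a::comm_ring_1 \<Rightarrow> ('a, 'p::finite) mpoly" where
  "mpoly_const c \<equiv> Poly_Mapping.single 0 c"

lemma mpoly_eval_const [simp]: "mpoly_eval (mpoly_const c) z = c"
  by (simp add: mpoly_eval_single monom_eval_def)

lemma mpoly_eval_one [simp]: "mpoly_eval 1 z = 1"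
  by (metis mpoly_eval_const single_one)

lemma mpoly_eval_power [simp]: "mpoly_eval (f ^ n) z = mpoly_eval f z ^ n"
  by (induction n) auto

lemma mpoly_eval_prod [simp]: "mpoly_eval (prod f A) z = (\<Prod>a\<in>A. mpoly_eval (f a) z)"
  by (induction A rule: infinite_finite_induct) auto

text \<open>Closure under sums, products and determinants allows the Jacobian determinant and
  Cramer's formulas to be recognised as polynomials without their coefficients being written
  down.\<close>

definition polynomial_fun :: "('a::comm_ring_1 ^ 'p::finite \<Rightarrow> 'a) \<Rightarrow> bool" where
  "polynomial_fun \<phi> \<longleftrightarrow> (\<exists>f. \<phi> = mpoly_eval f)"

lemma polynomial_fun_eval [intro, simp]: "polynomial_fun (mpoly_eval f)"
  by (auto simp: polynomial_fun_def)

lemma polynomial_fun_const [intro, simp]: "polynomial_fun (\<lambda>z. c)"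
  unfolding polynomial_fun_def by (rule exI[of _ "mpoly_const c"]) auto

lemma polynomial_fun_add [intro]:
  assumes "polynomial_fun \<phi>" "polynomial_fun \<psi>" shows "polynomial_fun (\<lambda>z. \<phi> z + \<psi> z)"
proof -
  obtain f g where "\<phi> = mpoly_eval f" "\<psi> = mpoly_eval g"
    using assms by (auto simp: polynomial_fun_def)
  then show ?thesis unfolding polynomial_fun_def by (intro exI[of _ "f + g"]) auto
qed

lemma polynomial_fun_mult [intro]:
  assumes "polynomial_fun \<phi>" "polynomial_fun \<psi>" shows "polynomial_fun (\<lambda>z. \<phi> z * \<psi> z)"
proof -
  obtain f g where "\<phi> = mpoly_eval f" "\<psi> = mpoly_eval g"
    using assms by (auto simp: polynomial_fun_def)
  then show ?thesis unfolding polynomial_fun_def by (intro exI[of _ "f * g"]) auto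
qed

lemma polynomial_fun_sum [intro]:
  "(\<And>a. a \<in> A \<Longrightarrow> polynomial_fun (\<phi> a)) \<Longrightarrow> polynomial_fun (\<lambda>z. \<Sum>a\<in>A. \<phi> a z)"
  by (induction A rule: infinite_finite_induct) auto

lemma polynomial_fun_prod [intro]:
  "(\<And>a. a \<in> A \<Longrightarrow> polynomial_fun (\<phi> a)) \<Longrightarrow> polynomial_fun (\<lambda>z. \<Prod>a\<in>A. \<phi> a z)"
  by (induction A rule: infinite_finite_induct) auto

lemma polynomial_fun_det:
  assumes "\<And>i j. polynomial_fun (\<lambda>z. A z $ i $ j)"
  shows "polynomial_fun (\<lambda>z. det (A z :: 'a::comm_ring_1 ^ 'n ^ 'n))"
  unfolding det_def by (intro polynomial_fun_sum polynomial_fun_mult polynomial_fun_prod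
      polynomial_fun_const assms)

definition mpoly_grad :: "('a::comm_ring_1, 'p::finite) mpoly \<Rightarrow> 'a ^ 'p \<Rightarrow> 'a ^ 'p" where
  "mpoly_grad f z = (\<chi> i. mpoly_eval (mpoly_pderiv i f) z)"

lemma mpoly_eval_pderiv:
  assumes "finite A" "Poly_Mapping.keys f \<subseteq> A"
  shows "mpoly_eval (mpoly_pderiv i f) z = (\<Sum>m\<in>A. of_nat (Poly_Mapping.lookup m i) *
    Poly_Mapping.lookup f m * monom_eval (m - Poly_Mapping.single i 1) z)"
  unfolding mpoly_pderiv_def mpoly_eval_sum mpoly_eval_single using assms
  by (intro sum.mono_neutral_left) (auto simp: in_keys_iff)

lemma monom_eval_minus_single:
  "monom_eval (m - Poly_Mapping.single i 1) z =
     (z $ i) ^ (Poly_Mapping.lookup m i - 1) * (\<Prod>j\<in>UNIV - {i}. (z $ j) ^ Poly_Mapping.lookup m j)"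
  unfolding monom_eval_def
  by (subst prod.remove[of _ i]) (auto simp: lookup_minus lookup_single when_def intro!: prod.cong)

lemma has_derivative_monom_eval:
  fixes z :: "'a::real_normed_field ^ 'p::finite"
  shows "(monom_eval m has_derivative (\<lambda>v. \<Sum>i\<in>UNIV. of_nat (Poly_Mapping.lookup m i) *
    monom_eval (m - Poly_Mapping.single i 1) z * v $ i)) (at z)"
proof -
  have "((\<lambda>z. \<Prod>i\<in>UNIV. (z $ i) ^ Poly_Mapping.lookup m i) has_derivative
      (\<lambda>v. \<Sum>i\<in>UNIV. (of_nat (Poly_Mapping.lookup m i) * (v $ i) * (z $ i) ^ (Poly_Mapping.lookup m i - 1))
        * (\<Prod>j\<in>UNIV - {i}. (z $ j) ^ Poly_Mapping.lookup m j))) (at z)"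
    by (intro has_derivative_prod has_derivative_power bounded_linear.has_derivative[OF bounded_linear_vec_nth]
        has_derivative_ident)
  then show ?thesis
    unfolding monom_eval_minus_single by (simp add: monom_eval_def[abs_def] mult_ac)
qed

lemma has_derivative_mpoly_eval:
  fixes z :: "'a::real_normed_field ^ 'p::finite"
  shows "(mpoly_eval f has_derivative (\<lambda>v. \<Sum>i\<in>UNIV. mpoly_grad f z $ i * v $ i)) (at z)"
proof -
  have "((\<lambda>z. \<Sum>m\<in>Poly_Mapping.keys f. Poly_Mapping.lookup f m * monom_eval m z) has_derivative
      (\<lambda>v. \<Sum>m\<in>Poly_Mapping.keys f. Poly_Mapping.lookup f m *
        (\<Sum>i\<in>UNIV. of_nat (Poly_Mapping.lookup m i) *
          monom_eval (m - Poly_Mapping.single i 1) z * v $ i))) (at z)"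
    by (intro has_derivative_sum has_derivative_mult_right has_derivative_monom_eval)
  also have "(\<lambda>v. \<Sum>m\<in>Poly_Mapping.keys f. Poly_Mapping.lookup f m *
        (\<Sum>i\<in>UNIV. of_nat (Poly_Mapping.lookup m i) *
          monom_eval (m - Poly_Mapping.single i 1) z * v $ i)) =
      (\<lambda>v. \<Sum>i\<in>UNIV. mpoly_grad f z $ i * v $ i)"
  proof
    fix v :: "'a ^ 'p"
    show "(\<Sum>m\<in>Poly_Mapping.keys f. Poly_Mapping.lookup f m *
        (\<Sum>i\<in>UNIV. of_nat (Poly_Mapping.lookup m i) *
          monom_eval (m - Poly_Mapping.single i 1) z * v $ i)) =
      (\<Sum>i\<in>UNIV. mpoly_grad f z $ i * v $ i)"
      unfolding mpoly_grad_def vec_lambda_beta mpoly_eval_pderiv[OF finite_keys order_refl]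
      by (subst sum_distrib_left, subst sum.swap) (simp add: sum_distrib_left sum_distrib_right mult_ac)
  qed
  finally show ?thesis
    by (simp add: mpoly_eval_def[abs_def] monom_eval_def[abs_def])
qed

lemma has_derivative_mpoly_eval_real:
  fixes z :: "real ^ 'p::finite"
  shows "(mpoly_eval f has_derivative (\<lambda>v. mpoly_grad f z \<bullet> v)) (at z)"
  using has_derivative_mpoly_eval[of f z] by (simp add: inner_vec_def)

lemma continuous_on_mpoly_eval:
  "continuous_on S (mpoly_eval f :: 'a::real_normed_field ^ 'p::finite \<Rightarrow> 'a)"
  by (meson has_derivative_continuous_on has_derivative_mpoly_eval has_derivative_at_withinI)

text \<open>The analytic derivative determines the formal gradient, so product rules for
  \<open>mpoly_pderiv\<close> can be taken from calculus.\<close>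

lemma mpoly_grad_eqI:
  fixes z :: "'a::real_normed_field ^ 'p::finite"
  assumes "(mpoly_eval f has_derivative (\<lambda>v. \<Sum>i\<in>UNIV. w $ i * v $ i)) (at z)"
  shows "mpoly_grad f z = w"
proof -
  have eq: "(\<lambda>v. \<Sum>i\<in>UNIV. mpoly_grad f z $ i * v $ i) = (\<lambda>v. \<Sum>i\<in>UNIV. w $ i * v $ i)"
    by (rule has_derivative_unique[OF has_derivative_mpoly_eval assms])
  have "mpoly_grad f z $ j = w $ j" for j
    using fun_cong[OF eq, of "axis j 1"] by (simp add: axis_def if_distrib cong: if_cong)
  then show ?thesis
    by (simp add: vec_eq_iff)
qed

text \<open>In the product rule the gradient of \<open>h g\<close> is multiplied by
  \<open>mpoly_eval g z\<close>, which is zero. At a common zero of generators, gradients of ideal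
  elements are thus combinations of the gradients of the generators.\<close>

lemma mpoly_grad_combination:
  fixes z :: "'a::real_normed_field ^ 'p::finite"
  assumes "\<And>g. g \<in> G \<Longrightarrow> mpoly_eval g z = 0"
  shows "mpoly_grad (\<Sum>g\<in>G. h g * g) z = (\<Sum>g\<in>G. mpoly_eval (h g) z *s mpoly_grad g z)"
proof (rule mpoly_grad_eqI)
  have "((\<lambda>z. \<Sum>g\<in>G. mpoly_eval (h g) z * mpoly_eval g z) has_derivative
      (\<lambda>v. \<Sum>g\<in>G. mpoly_eval (h g) z * (\<Sum>i\<in>UNIV. mpoly_grad g z $ i * v $ i) +
         (\<Sum>i\<in>UNIV. mpoly_grad (h g) z $ i * v $ i) * mpoly_eval g z)) (at z)"
    by (intro has_derivative_sum has_derivative_mult has_derivative_mpoly_eval)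
  also have "(\<lambda>v. \<Sum>g\<in>G. mpoly_eval (h g) z * (\<Sum>i\<in>UNIV. mpoly_grad g z $ i * v $ i) +
         (\<Sum>i\<in>UNIV. mpoly_grad (h g) z $ i * v $ i) * mpoly_eval g z) =
      (\<lambda>v. \<Sum>i\<in>UNIV. (\<Sum>g\<in>G. mpoly_eval (h g) z *s mpoly_grad g z) $ i * v $ i)"
    (is "?l = ?r")
  proof
    fix v :: "'a ^ 'p"
    have "?l v = (\<Sum>g\<in>G. \<Sum>i\<in>UNIV. mpoly_eval (h g) z * mpoly_grad g z $ i * v $ i)"
      by (intro sum.cong) (auto simp: assms sum_distrib_left mult_ac)
    also have "\<dots> = ?r v"
      by (subst sum.swap) (simp add: sum_distrib_right)
    finally show "?l v = ?r v" .
  qed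
  finally show "(mpoly_eval (\<Sum>g\<in>G. h g * g) has_derivative
      (\<lambda>v. \<Sum>i\<in>UNIV. (\<Sum>g\<in>G. mpoly_eval (h g) z *s mpoly_grad g z) $ i * v $ i)) (at z)"
    by (simp add: has_derivative_transform)
qed

subsection \<open>Real points of complex polynomials\<close>

abbreviation mpoly_Re :: "(complex, 'p::finite) mpoly \<Rightarrow> (real, 'p) mpoly" where
  "mpoly_Re \<equiv> Poly_Mapping.map Re"

abbreviation mpoly_Im :: "(complex, 'p::finite) mpoly \<Rightarrow> (real, 'p) mpoly" where
  "mpoly_Im \<equiv> Poly_Mapping.map Im"

lemma monom_eval_complex_vec: "monom_eval m (complex_vec x) = of_real (monom_eval m x)"
  by (simp add: monom_eval_def complex_vec_def)

lemma keys_map_subset: "Poly_Mapping.keys (Poly_Mapping.map f p) \<subseteq> Poly_Mapping.keys p"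
  by (auto simp: in_keys_iff map.rep_eq when_def)

lemma lookup_map: "f 0 = 0 \<Longrightarrow> Poly_Mapping.lookup (Poly_Mapping.map f p) m = f (Poly_Mapping.lookup p m)"
  by (simp add: map.rep_eq when_def)

lemma mpoly_eval_complex_mpoly:
  "mpoly_eval (complex_mpoly f) (complex_vec x) = of_real (mpoly_eval f x)"
  unfolding complex_mpoly_def
  by (subst (1 2) mpoly_eval_eq_sum[of "Poly_Mapping.keys f"])
    (auto simp: keys_map_subset lookup_map monom_eval_complex_vec)

lemma mpoly_eval_Re: "mpoly_eval (mpoly_Re f) x = Re (mpoly_eval f (complex_vec x))"
  by (subst (1 2) mpoly_eval_eq_sum[of "Poly_Mapping.keys f"])
    (auto simp: keys_map_subset lookup_map monom_eval_complex_vec)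

lemma mpoly_eval_Im: "mpoly_eval (mpoly_Im f) x = Im (mpoly_eval f (complex_vec x))"
  by (subst (1 2) mpoly_eval_eq_sum[of "Poly_Mapping.keys f"])
    (auto simp: keys_map_subset lookup_map monom_eval_complex_vec)

lemma mpoly_grad_complex_mpoly:
  "mpoly_grad (complex_mpoly f) (complex_vec x) = complex_vec (mpoly_grad f x)"
proof -
  have "mpoly_eval (mpoly_pderiv i (complex_mpoly f)) (complex_vec x) =
      of_real (mpoly_eval (mpoly_pderiv i f) x)" for i
    unfolding complex_mpoly_def
    by (subst (1 2) mpoly_eval_pderiv[of "Poly_Mapping.keys f"])
      (auto simp: keys_map_subset lookup_map monom_eval_complex_vec)
  then show ?thesis
    by (simp add: mpoly_grad_def complex_vec_def vec_eq_iff)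
qed

lemma mpoly_grad_Re_Im:
  "mpoly_grad f (complex_vec x) =
     complex_vec (mpoly_grad (mpoly_Re f) x) + \<i> *s complex_vec (mpoly_grad (mpoly_Im f) x)"
proof -
  have "mpoly_eval (mpoly_pderiv i f) (complex_vec x) = of_real (mpoly_eval (mpoly_pderiv i (mpoly_Re f)) x)
      + \<i> * of_real (mpoly_eval (mpoly_pderiv i (mpoly_Im f)) x)" for i
    by (subst (1 2 3) mpoly_eval_pderiv[of "Poly_Mapping.keys f"])
      (auto simp: keys_map_subset lookup_map monom_eval_complex_vec complex_eq_iff)
  then show ?thesis
    by (simp add: mpoly_grad_def complex_vec_def vec_eq_iff)
qed

subsection \<open>Algebraic independence\<close>

text \<open>Gaussian elimination, one equation at a time: a nonzero entry \<open>a i0 m\<close>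
  eliminates the unknown \<open>i0\<close>, leaving a system with one unknown and one equation
  less.\<close>

lemma underdetermined_system:
  fixes a :: "'i \<Rightarrow> 'm \<Rightarrow> 'a::field"
  assumes "finite M" "finite I" "card M < card I"
  shows "\<exists>c. (\<exists>i\<in>I. c i \<noteq> 0) \<and> (\<forall>m\<in>M. (\<Sum>i\<in>I. c i * a i m) = 0)"
  using assms
proof (induction M arbitrary: I a rule: finite_induct)
  case empty
  then obtain i where "i \<in> I" by fastforce
  then show ?case by (intro exI[of _ "\<lambda>_. 1"]) auto
next
  case (insert m M)
  show ?case
  proof (cases "\<forall>i\<in>I. a i m = 0")
    case True
    have "card M < card I" using insert by simp
    then obtain c where "\<exists>i\<in>I. c i \<noteq> 0" "\<forall>m\<in>M. (\<Sum>i\<in>I. c i * a i m) = 0"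
      using insert.IH[of I a] insert.prems by blast
    with True show ?thesis by (intro exI[of _ c]) auto
  next
    case False
    then obtain i0 where i0: "i0 \<in> I" "a i0 m \<noteq> 0" by blast
    define J where "J = I - {i0}"
    have J: "finite J" "i0 \<notin> J" "I = insert i0 J" using i0 insert.prems by (auto simp: J_def)
    define a' where "a' i k = a i k - a i m / a i0 m * a i0 k" for i k
    have "card M < card J" using insert J by simp
    then obtain c where c: "\<exists>i\<in>J. c i \<noteq> 0" "\<forall>m\<in>M. (\<Sum>i\<in>J. c i * a' i m) = 0"
      using insert.IH[of J a'] J by blast
    \<comment> \<open>The value at \<open>i0\<close> is the one that equation \<open>m\<close>
      forces. With it, sums over \<open>I\<close> against \<open>a\<close> become sums over
      \<open>J\<close> against \<open>a'\<close>, and \<open>a' i m = 0\<close>.\<close>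
    define d where "d = c(i0 := - (\<Sum>i\<in>J. c i * (a i m / a i0 m)))"
    have dJ: "(\<Sum>i\<in>J. d i * a i k) = (\<Sum>i\<in>J. c i * a i k)" for k
      using J by (intro sum.cong) (auto simp: d_def)
    have key: "(\<Sum>i\<in>I. d i * a i k) = (\<Sum>i\<in>J. c i * a' i k)" for k
      using J by (simp add: dJ) (simp add: d_def a'_def right_diff_distrib sum_subtractf
          sum_distrib_left sum_distrib_right mult_ac times_divide_eq_right times_divide_eq_left)
    have "(\<Sum>i\<in>J. c i * a' i m) = 0" using i0 by (simp add: a'_def)
    with c key have "\<forall>k\<in>insert m M. (\<Sum>i\<in>I. d i * a i k) = 0" by auto
    moreover have "\<exists>i\<in>I. d i \<noteq> 0" using c J by (auto simp: d_def)
    ultimately show ?thesis by blast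
  qed
qed

lemma sum_PiE_insert:
  assumes "a \<notin> A"
  shows "(\<Sum>\<alpha>\<in>PiE (insert a A) (\<lambda>_. T). h \<alpha>) =
    (\<Sum>j\<in>T. \<Sum>\<alpha>\<in>PiE A (\<lambda>_. T). h (\<alpha>(a := j)))"
proof -
  have "(\<Sum>\<alpha>\<in>PiE (insert a A) (\<lambda>_. T). h \<alpha>) =
      (\<Sum>p\<in>T \<times> PiE A (\<lambda>_. T). h (case p of (j, \<alpha>) \<Rightarrow> \<alpha>(a := j)))"
    unfolding PiE_insert_eq by (subst sum.reindex) (use inj_combinator[OF assms] in auto)
  then show ?thesis
    by (simp add: sum.cartesian_product case_prod_unfold)
qed

text \<open>Induction on the variables: with the others fixed, a polynomial in one variable that
  vanishes at all reals has infinitely many roots, so its coefficients vanish, and these are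
  polynomials in the remaining variables.\<close>

lemma real_monomials_independent:
  assumes "finite B"
    and "\<And>y :: 'b \<Rightarrow> real. (\<Sum>\<beta>\<in>PiE B (\<lambda>_. {..s}). c \<beta> * (\<Prod>b\<in>B. of_real (y b) ^ \<beta> b)) = (0 :: complex)"
  shows "\<forall>\<beta>\<in>PiE B (\<lambda>_. {..s}). c \<beta> = 0"
  using assms
proof (induction B arbitrary: c rule: finite_induct)
  case empty
  then show ?case by simp
next
  case (insert b B)
  define F where "F j y = (\<Sum>\<alpha>\<in>PiE B (\<lambda>_. {..s}). c (\<alpha>(b := j)) * (\<Prod>i\<in>B. of_real (y i) ^ \<alpha> i))"
    for j and y :: "'b \<Rightarrow> real"
  have F0: "F j y = 0" if "j \<le> s" for j y
  proof -
    have "(\<Sum>j\<le>s. F j y * of_real t ^ j) = 0" for t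
    proof -
      have "(\<Prod>i\<in>B. complex_of_real ((y(b := t)) i) ^ (\<alpha>(b := j)) i) =
          (\<Prod>i\<in>B. of_real (y i) ^ \<alpha> i)" for \<alpha> :: "'b \<Rightarrow> nat" and j
        using insert.hyps by (intro prod.cong) auto
      then show ?thesis
        using insert.prems[of "y(b := t)"] insert.hyps
        by (simp add: sum_PiE_insert F_def sum_distrib_right mult_ac del: fun_upd_apply)
          (simp add: mult_ac sum_distrib_left)
    qed
    then have "range complex_of_real \<subseteq> {z. (\<Sum>j\<le>s. F j y * z ^ j) = 0}"
      by auto
    moreover have "infinite (range complex_of_real)"
      by (simp add: finite_image_iff inj_of_real infinite_UNIV_char_0)
    ultimately have "infinite {z. (\<Sum>j\<le>s. F j y * z ^ j) = 0}"
      using finite_subset by blast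
    then show ?thesis
      using that polyfun_finite_roots[of "\<lambda>j. F j y" s] by blast
  qed
  have "\<forall>\<alpha>\<in>PiE B (\<lambda>_. {..s}). c (\<alpha>(b := j)) = 0" if "j \<le> s" for j
    by (rule insert.IH) (use F0[OF that] in \<open>simp add: F_def del: fun_upd_apply\<close>)
  then show ?case
    by (auto simp: PiE_insert_eq)
qed

text \<open>Independence of the restrictions to the point set \<open>Z\<close>. Exponents are
  bounded one by one by a common \<open>s\<close>, not by total degree: for finite \<open>A\<close>
  the index set is then a box with \<open>(s + 1) ^ card A\<close> elements, from which one variable
  at a time can be split off.\<close>

definition alg_independent ::
    "('a::comm_ring_1 ^ 'p::finite) set \<Rightarrow> 'i set \<Rightarrow> ('i \<Rightarrow> ('a, 'p) mpoly) \<Rightarrow> bool" where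
  "alg_independent Z A t \<longleftrightarrow> (\<forall>s c.
     (\<forall>z\<in>Z. (\<Sum>\<alpha>\<in>PiE A (\<lambda>_. {..s}). c \<alpha> * (\<Prod>i\<in>A. mpoly_eval (t i) z ^ \<alpha> i)) = 0) \<longrightarrow>
     (\<forall>\<alpha>\<in>PiE A (\<lambda>_. {..s}). c \<alpha> = 0))"

lemma alg_independentD:
  assumes "alg_independent Z A t"
    and "\<And>z. z \<in> Z \<Longrightarrow> (\<Sum>\<alpha>\<in>PiE A (\<lambda>_. {..s}). c \<alpha> * (\<Prod>i\<in>A. mpoly_eval (t i) z ^ \<alpha> i)) = 0"
    and "\<alpha> \<in> PiE A (\<lambda>_. {..s})"
  shows "c \<alpha> = 0"
  using assms unfolding alg_independent_def by blast

lemma alg_independent_mono: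
  "alg_independent Z A t \<Longrightarrow> Z \<subseteq> Z' \<Longrightarrow> alg_independent Z' A t"
  unfolding alg_independent_def by (meson subsetD)

lemma algebraic_set_Int_zero:
  assumes "algebraic_set Z"
  shows "algebraic_set {z\<in>Z. mpoly_eval f z = 0}"
proof -
  obtain F where "finite F" "Z = zero_set F" using assms by (auto simp: algebraic_set_def)
  then show ?thesis
    unfolding algebraic_set_def by (intro exI[of _ "insert f F"]) (auto simp: zero_set_def)
qed

text \<open>The vanishing ideal is prime: otherwise the zero sets of the two factors would cover
  \<open>Z\<close> by proper algebraic subsets.\<close>

lemma irreducible_set_mult:
  fixes Z :: "('a::idom ^ 'p::finite) set"
  assumes "irreducible_set Z" "\<And>z. z \<in> Z \<Longrightarrow> mpoly_eval f z * mpoly_eval g z = 0"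
  shows "(\<forall>z\<in>Z. mpoly_eval f z = 0) \<or> (\<forall>z\<in>Z. mpoly_eval g z = 0)"
proof (rule ccontr)
  assume neg: "\<not> ?thesis"
  have "algebraic_set {z\<in>Z. mpoly_eval f z = 0}" "algebraic_set {z\<in>Z. mpoly_eval g z = 0}"
    using assms(1) by (auto simp: irreducible_set_def intro: algebraic_set_Int_zero)
  moreover have "{z\<in>Z. mpoly_eval f z = 0} \<subset> Z" "{z\<in>Z. mpoly_eval g z = 0} \<subset> Z"
    using neg by auto
  moreover have "Z = {z\<in>Z. mpoly_eval f z = 0} \<union> {z\<in>Z. mpoly_eval g z = 0}"
    using assms(2) by auto
  ultimately show False
    using assms(1) unfolding irreducible_set_def by blast
qed

text \<open>Write a relation on \<open>Z'\<close> as the sum of the \<open>f ^ j * F j\<close>, with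
  \<open>F j\<close> polynomial in the \<open>t i\<close>. Once \<open>F l\<close> is zero for
  \<open>l < j\<close>, the factor \<open>f ^ j\<close> can be cancelled on the irreducible
  \<open>Z'\<close>; on \<open>Z\<close>, where \<open>f\<close> vanishes, only \<open>F j\<close>
  is left, and independence on \<open>Z\<close> kills its coefficients.\<close>

lemma alg_independent_insert:
  fixes Z Z' :: "('a::idom ^ 'p::finite) set"
  assumes ind: "alg_independent Z A t" and sub: "Z \<subseteq> Z'" and irr: "irreducible_set Z'"
    and f0: "\<And>z. z \<in> Z \<Longrightarrow> mpoly_eval f z = 0" and f1: "z1 \<in> Z'" "mpoly_eval f z1 \<noteq> 0"
    and A: "finite A" "k \<notin> A"
  shows "alg_independent Z' (insert k A) (t(k := f))"
  unfolding alg_independent_def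
proof (intro allI impI)
  fix s and c :: "('b \<Rightarrow> nat) \<Rightarrow> 'a"
  let ?E = "PiE A (\<lambda>_. {..s :: nat})"
  assume H: "\<forall>z\<in>Z'. (\<Sum>\<alpha>\<in>PiE (insert k A) (\<lambda>_. {..s :: nat}).
    c \<alpha> * (\<Prod>i\<in>insert k A. mpoly_eval ((t(k := f)) i) z ^ \<alpha> i)) = 0"
  define F where "F j = (\<Sum>\<alpha>\<in>?E. mpoly_const (c (\<alpha>(k := j))) * (\<Prod>i\<in>A. t i ^ \<alpha> i))" for j
  have prodA: "(\<Prod>i\<in>A. mpoly_eval ((t(k := f)) i) z ^ (\<alpha>(k := j)) i) =
      (\<Prod>i\<in>A. mpoly_eval (t i) z ^ \<alpha> i)" for \<alpha> j z
    using A by (intro prod.cong) auto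
  have sumF: "(\<Sum>j\<le>s. mpoly_eval f z ^ j * mpoly_eval (F j) z) = 0" if "z \<in> Z'" for z
    using bspec[OF H that] A
    by (simp add: sum_PiE_insert prodA F_def sum_distrib_left mult_ac del: fun_upd_apply)
      (simp add: mult_ac)
  have "\<forall>\<alpha>\<in>?E. c (\<alpha>(k := j)) = 0" if "j \<le> s" for j
    using that
  proof (induction j rule: less_induct)
    case (less j)
    have Fz: "F l = 0" if "l < j" for l
      using less.IH[OF that] less.prems that by (simp add: F_def del: fun_upd_apply)
    define H where "H = F j + f * (\<Sum>l\<in>{Suc j..s}. f ^ (l - Suc j) * F l)"
    have "mpoly_eval (f ^ j) z * mpoly_eval H z = 0" if "z \<in> Z'" for z
    proof -
      have "(\<Sum>l\<le>s. mpoly_eval f z ^ l * mpoly_eval (F l) z) =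
          (\<Sum>l\<in>{j..s}. mpoly_eval f z ^ l * mpoly_eval (F l) z)"
        by (rule sum.mono_neutral_right) (auto simp: Fz)
      also have "{j..s} = insert j {Suc j..s}" using less.prems by auto
      also have "(\<Sum>l\<in>\<dots>. mpoly_eval f z ^ l * mpoly_eval (F l) z) =
          mpoly_eval f z ^ j * mpoly_eval (F j) z +
          (\<Sum>l\<in>{Suc j..s}. mpoly_eval f z ^ l * mpoly_eval (F l) z)"
        by simp
      also have "(\<Sum>l\<in>{Suc j..s}. mpoly_eval f z ^ l * mpoly_eval (F l) z) =
          (\<Sum>l\<in>{Suc j..s}. mpoly_eval f z ^ j * (mpoly_eval f z *
             (mpoly_eval f z ^ (l - Suc j) * mpoly_eval (F l) z)))"
        by (intro sum.cong refl) (simp flip: mult.assoc power_Suc2 power_add power_Suc)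
      finally show ?thesis
        using sumF[OF that] by (simp add: H_def sum_distrib_left distrib_left)
    qed
    then have "\<forall>z\<in>Z'. mpoly_eval H z = 0"
      using irreducible_set_mult[OF irr, of "f ^ j" H] f1 by auto
    then have "mpoly_eval (F j) z = 0" if "z \<in> Z" for z
      using that sub f0[OF that] by (fastforce simp: H_def)
    then have "(\<Sum>\<alpha>\<in>?E. c (\<alpha>(k := j)) * (\<Prod>i\<in>A. mpoly_eval (t i) z ^ \<alpha> i)) = 0"
      if "z \<in> Z" for z
      using that by (simp add: F_def)
    then show ?case
      using alg_independentD[OF ind, where s = s and c = "\<lambda>\<alpha>. c (\<alpha>(k := j))"] by blast
  qed
  then show "\<forall>\<alpha>\<in>PiE (insert k A) (\<lambda>_. {..s}). c \<alpha> = 0"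
    by (auto simp: PiE_insert_eq)
qed

text \<open>Each strict inclusion supplies a polynomial that vanishes on the smaller set but not on
  the larger one; this is the next independent element.\<close>

lemma chain_alg_independent:
  fixes Z :: "nat \<Rightarrow> ('a::idom ^ 'p::finite) set"
  assumes "\<And>i. i \<le> n \<Longrightarrow> irreducible_set (Z i)" "\<And>i. i < n \<Longrightarrow> Z i \<subset> Z (Suc i)"
  shows "\<exists>t :: nat \<Rightarrow> ('a, 'p) mpoly. alg_independent (Z n) {..<n} t"
  using assms
proof (induction n)
  case 0
  then have "Z 0 \<noteq> {}" by (simp add: irreducible_set_def)
  then show ?case by (auto simp: alg_independent_def)
next
  case (Suc n)
  then obtain t where t: "alg_independent (Z n) {..<n} (t :: nat \<Rightarrow> ('a, 'p) mpoly)"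
    by (metis le_SucI less_SucI)
  have "algebraic_set (Z n)" using Suc.prems(1)[of n] by (simp add: irreducible_set_def)
  then obtain F where F: "Z n = zero_set F" by (auto simp: algebraic_set_def)
  obtain z1 where z1: "z1 \<in> Z (Suc n)" "z1 \<notin> Z n" using Suc.prems(2)[of n] by auto
  then obtain f where f: "f \<in> F" "mpoly_eval f z1 \<noteq> 0" by (auto simp: F zero_set_def)
  have "alg_independent (Z (Suc n)) (insert n {..<n}) (t(n := f))"
  proof (rule alg_independent_insert[OF t _ _ _ z1(1)])
    show "Z n \<subseteq> Z (Suc n)" using Suc.prems(2)[of n] by auto
    show "irreducible_set (Z (Suc n))" using Suc.prems(1) by simp
    show "mpoly_eval f z = 0" if "z \<in> Z n" for z
      using that f by (simp add: F zero_set_def)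
  qed (use f in auto)
  then show ?case
    by (metis lessThan_Suc)
qed

section \<open>Passage from the complex variety to its real points\<close>

lemma zero_on_complexification:
  assumes "\<And>x. x \<in> V \<Longrightarrow> mpoly_eval f (complex_vec x) = 0" "z \<in> complexification V"
  shows "mpoly_eval f z = 0"
proof -
  have "algebraic_set (zero_set {f})" unfolding algebraic_set_def by blast
  moreover have "complex_vec ` V \<subseteq> zero_set {f}" using assms(1) by (auto simp: zero_set_def)
  ultimately have "z \<in> zero_set {f}" using assms(2) unfolding complexification_def by blast
  then show ?thesis by (simp add: zero_set_def)
qed

lemma complex_vec_in_complexification: "x \<in> V \<Longrightarrow> complex_vec x \<in> complexification V"
  by (auto simp: complexification_def)

text \<open>The points of \<open>V\<close> are Zariski dense in the complexification, so a relation
  on them extends. Real points are wanted because the real gradients and the irreducibility of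
  \<open>V\<close> are used next.\<close>

lemma alg_independent_real_points:
  fixes t :: "'i \<Rightarrow> (complex, 'p::finite) mpoly"
  assumes "alg_independent (complexification V) A t"
  shows "alg_independent (complex_vec ` V) A t"
  unfolding alg_independent_def
proof (intro allI impI)
  fix s and c :: "('i \<Rightarrow> nat) \<Rightarrow> complex"
  let ?E = "PiE A (\<lambda>_. {..s :: nat})"
  define f where "f = (\<Sum>\<alpha>\<in>?E. mpoly_const (c \<alpha>) * (\<Prod>i\<in>A. t i ^ \<alpha> i))"
  have ev: "mpoly_eval f z = (\<Sum>\<alpha>\<in>?E. c \<alpha> * (\<Prod>i\<in>A. mpoly_eval (t i) z ^ \<alpha> i))" for z
    by (simp add: f_def)
  assume "\<forall>z\<in>complex_vec ` V. (\<Sum>\<alpha>\<in>?E. c \<alpha> * (\<Prod>i\<in>A. mpoly_eval (t i) z ^ \<alpha> i)) = 0"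
  then have "mpoly_eval f (complex_vec x) = 0" if "x \<in> V" for x
    using that ev by auto
  then have "\<forall>z\<in>complexification V. mpoly_eval f z = 0"
    using zero_on_complexification by blast
  then show "\<forall>\<alpha>\<in>?E. c \<alpha> = 0"
    using assms ev unfolding alg_independent_def by auto
qed

lemma tendsto_difference_quotient:
  fixes g :: "(real, 'p::finite) mpoly"
  assumes "mpoly_eval g x = 0"
  shows "((\<lambda>\<tau>. mpoly_eval g (x + \<tau> *\<^sub>R v) / \<tau>) \<longlongrightarrow> mpoly_grad g x \<bullet> v) (at 0)"
proof -
  have "((\<lambda>\<tau>. mpoly_eval g (x + \<tau> *\<^sub>R v)) has_derivative (\<lambda>\<tau>. mpoly_grad g (x + 0 *\<^sub>R v) \<bullet> (0 + \<tau> *\<^sub>R v))) (at 0)"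
    by (rule has_derivative_compose[where g = "mpoly_eval g"])
      (auto intro!: derivative_eq_intros has_derivative_mpoly_eval_real simp del: add_0_left)
  also have "(\<lambda>\<tau>. mpoly_grad g (x + 0 *\<^sub>R v) \<bullet> (0 + \<tau> *\<^sub>R v)) = (*) (mpoly_grad g x \<bullet> v)"
    by (auto simp: mult_ac)
  finally have "((\<lambda>\<tau>. mpoly_eval g (x + \<tau> *\<^sub>R v)) has_field_derivative (mpoly_grad g x \<bullet> v)) (at 0)"
    by (simp add: has_field_derivative_def)
  then show ?thesis
    using assms by (simp add: DERIV_def)
qed

text \<open>Along \<open>x + \<tau> v\<close> with \<open>x \<in> V\<close>, the terms of lowest total degree \<open>q\<close> in the \<open>g b\<close> are the
  leading coefficient of \<open>\<tau> ^ q\<close>, a polynomial in the freely prescribed numbers \<open>grad (g b) \<bullet> v\<close>.\<close>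

lemma alg_independent_with_equations:
  fixes V :: "(real ^ 'p::finite) set" and t :: "'i \<Rightarrow> (complex, 'p) mpoly"
    and g :: "'b \<Rightarrow> (real, 'p) mpoly"
  assumes irr: "irreducible_set V" and ind: "alg_independent (complex_vec ` V) A t"
    and fin: "finite A" "finite B"
    and gV: "\<And>b x. b \<in> B \<Longrightarrow> x \<in> V \<Longrightarrow> mpoly_eval (g b) x = 0"
    and D: "x0 \<in> V" "mpoly_eval D x0 \<noteq> 0"
    and surj: "\<And>x y. x \<in> V \<Longrightarrow> mpoly_eval D x \<noteq> 0 \<Longrightarrow> \<exists>v. \<forall>b\<in>B. mpoly_grad (g b) x \<bullet> v = y b"
    and H: "\<And>x. (\<Sum>\<beta>\<in>PiE B (\<lambda>_. {..s}). \<Sum>\<alpha>\<in>PiE A (\<lambda>_. {..s}). c \<alpha> \<beta> *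
        ((\<Prod>i\<in>A. mpoly_eval (t i) (complex_vec x) ^ \<alpha> i) *
         (\<Prod>b\<in>B. of_real (mpoly_eval (g b) x) ^ \<beta> b))) = 0"
    and \<alpha>\<beta>: "\<alpha> \<in> PiE A (\<lambda>_. {..s})" "\<beta> \<in> PiE B (\<lambda>_. {..s})"
  shows "c \<alpha> \<beta> = 0"
proof -
  let ?A = "PiE A (\<lambda>_. {..s :: nat})" and ?B = "PiE B (\<lambda>_. {..s :: nat})"
  define F where "F \<beta> = (\<Sum>\<alpha>\<in>?A. mpoly_const (c \<alpha> \<beta>) * (\<Prod>i\<in>A. t i ^ \<alpha> i))" for \<beta>
  have HF: "(\<Sum>\<beta>\<in>?B. mpoly_eval (F \<beta>) (complex_vec x) *
      (\<Prod>b\<in>B. of_real (mpoly_eval (g b) x) ^ \<beta> b)) = 0" for x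
    using H[of x] by (simp add: F_def sum_distrib_right mult_ac sum_distrib_left)
  have "\<forall>\<beta>\<in>?B. sum \<beta> B = q \<longrightarrow> (\<forall>\<alpha>\<in>?A. c \<alpha> \<beta> = 0)" for q
  proof (induction q rule: less_induct)
    case (less q)
    have F0: "F \<beta> = 0" if "\<beta> \<in> ?B" "sum \<beta> B < q" for \<beta>
      using less.IH[OF that(2)] that by (simp add: F_def)
    have zero_x: "mpoly_eval (F \<beta>) (complex_vec x) = 0"
      if x: "x \<in> V" "mpoly_eval D x \<noteq> 0" and \<beta>: "\<beta> \<in> ?B" "sum \<beta> B = q" for x \<beta>
    proof -
      \<comment> \<open>The factor \<open>0 ^ (sum \<beta> B - q)\<close> selects degree
        \<open>q\<close>, where it is \<open>0 ^ 0 = 1\<close>. Truncated subtraction makes it 1 in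
        lower degrees too, but there \<open>F \<beta> = 0\<close>.\<close>
      define d where "d \<beta> = mpoly_eval (F \<beta>) (complex_vec x) * 0 ^ (sum \<beta> B - q)" for \<beta>
      have "(\<Sum>\<beta>\<in>?B. d \<beta> * (\<Prod>b\<in>B. of_real (y b) ^ \<beta> b)) = 0" for y :: "'b \<Rightarrow> real"
      proof -
        obtain v where v: "\<forall>b\<in>B. mpoly_grad (g b) x \<bullet> v = y b"
          using surj[OF x, of y] by blast
        \<comment> \<open>The relation along the line, divided by \<open>\<tau> ^ q\<close>; each
          \<open>g b\<close> absorbs one power of \<open>\<tau>\<close> because it vanishes at
          \<open>x\<close>.\<close>
        define L where "L \<tau> = (\<Sum>\<beta>\<in>?B. mpoly_eval (F \<beta>) (complex_vec (x + \<tau> *\<^sub>R v)) *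
            of_real \<tau> ^ (sum \<beta> B - q) *
            (\<Prod>b\<in>B. of_real (mpoly_eval (g b) (x + \<tau> *\<^sub>R v) / \<tau>) ^ \<beta> b))" for \<tau> :: real
        have "continuous_on UNIV (\<lambda>\<tau>. mpoly_eval f (complex_vec (x + \<tau> *\<^sub>R v)))" for f
          unfolding complex_vec_def
          by (rule continuous_on_compose2[OF continuous_on_mpoly_eval[of UNIV]])
            (auto intro!: continuous_intros)
        then have "((\<lambda>\<tau>. mpoly_eval f (complex_vec (x + \<tau> *\<^sub>R v))) \<longlongrightarrow>
            mpoly_eval f (complex_vec (x + 0 *\<^sub>R v))) (at 0)" for f
          by (meson UNIV_I continuous_on_def)
        moreover have "((\<lambda>\<tau>. mpoly_eval (g b) (x + \<tau> *\<^sub>R v) / \<tau>) \<longlongrightarrow> y b) (at 0)" if "b \<in> B" for b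
          using tendsto_difference_quotient[of "g b" x v] gV \<open>x \<in> V\<close> that v by auto
        ultimately have "(L \<longlongrightarrow> (\<Sum>\<beta>\<in>?B. mpoly_eval (F \<beta>) (complex_vec (x + 0 *\<^sub>R v)) *
            of_real 0 ^ (sum \<beta> B - q) * (\<Prod>b\<in>B. of_real (y b) ^ \<beta> b))) (at 0)"
          unfolding L_def by (intro tendsto_intros)
        moreover have "L \<tau> = 0" if "\<tau> \<noteq> 0" for \<tau>
        proof -
          have "of_real \<tau> ^ q * L \<tau> = (\<Sum>\<beta>\<in>?B. mpoly_eval (F \<beta>) (complex_vec (x + \<tau> *\<^sub>R v)) *
            (\<Prod>b\<in>B. of_real (mpoly_eval (g b) (x + \<tau> *\<^sub>R v)) ^ \<beta> b))"
            unfolding L_def sum_distrib_left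
          proof (intro sum.cong refl)
            fix \<beta> assume \<beta>: "\<beta> \<in> ?B"
            let ?G = "\<Prod>b\<in>B. complex_of_real (mpoly_eval (g b) (x + \<tau> *\<^sub>R v)) ^ \<beta> b"
            have G: "(\<Prod>b\<in>B. complex_of_real (mpoly_eval (g b) (x + \<tau> *\<^sub>R v) / \<tau>) ^ \<beta> b) =
                ?G / of_real \<tau> ^ sum \<beta> B"
              by (simp add: power_divide prod_dividef power_sum)
            show "of_real \<tau> ^ q * (mpoly_eval (F \<beta>) (complex_vec (x + \<tau> *\<^sub>R v)) *
                complex_of_real \<tau> ^ (sum \<beta> B - q) *
                (\<Prod>b\<in>B. complex_of_real (mpoly_eval (g b) (x + \<tau> *\<^sub>R v) / \<tau>) ^ \<beta> b)) =
                mpoly_eval (F \<beta>) (complex_vec (x + \<tau> *\<^sub>R v)) * ?G"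
            proof (cases "sum \<beta> B < q")
              case True
              then show ?thesis using F0[OF \<beta>] by simp
            next
              case False
              then have "of_real \<tau> ^ q * complex_of_real \<tau> ^ (sum \<beta> B - q) = of_real \<tau> ^ sum \<beta> B"
                by (simp flip: power_add)
              then show ?thesis
                unfolding G using \<open>\<tau> \<noteq> 0\<close> by (simp add: field_simps)
            qed
          qed
          also have "\<dots> = 0" by (rule HF)
          finally show ?thesis using that by simp
        qed
        then have "(L \<longlongrightarrow> 0) (at 0)"
          by (intro tendsto_eventually) (auto simp: eventually_at_filter)
        ultimately show ?thesis
          using tendsto_unique[of "at (0::real)"] by (fastforce simp: d_def)
      qed
      then have "d \<beta> = 0"
        using real_monomials_independent[OF fin(2), where s = s and c = d] that by blast
      then show ?thesis using that by (simp add: d_def)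
    qed
    show ?case
    proof (intro ballI impI)
      fix \<beta> \<alpha> assume \<beta>: "\<beta> \<in> ?B" "sum \<beta> B = q" and \<alpha>: "\<alpha> \<in> ?A"
      \<comment> \<open>\<open>F \<beta>\<close> is known to vanish only where \<open>D\<close> does
        not. Multiplying by \<open>D\<close> and cancelling by primality extends this to all of
        \<open>V\<close>. Real and imaginary parts are treated separately since irreducibility of
        \<open>V\<close> concerns real polynomials.\<close>
      have "mpoly_eval (mpoly_Re (F \<beta>)) x * mpoly_eval D x = 0"
        "mpoly_eval (mpoly_Im (F \<beta>)) x * mpoly_eval D x = 0" if "x \<in> V" for x
        using zero_x[OF that _ \<beta>] by (auto simp: mpoly_eval_Re mpoly_eval_Im)
      then have "mpoly_eval (mpoly_Re (F \<beta>)) x = 0" "mpoly_eval (mpoly_Im (F \<beta>)) x = 0" if "x \<in> V" for x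
        using irreducible_set_mult[OF irr, of "mpoly_Re (F \<beta>)" D]
          irreducible_set_mult[OF irr, of "mpoly_Im (F \<beta>)" D] D that by blast+
      then have "mpoly_eval (F \<beta>) (complex_vec x) = 0" if "x \<in> V" for x
        using that by (simp add: mpoly_eval_Re mpoly_eval_Im complex_eq_iff)
      then have "\<forall>z\<in>complex_vec ` V. (\<Sum>\<alpha>\<in>?A. c \<alpha> \<beta> * (\<Prod>i\<in>A. mpoly_eval (t i) z ^ \<alpha> i)) = 0"
        by (simp add: F_def)
      then show "c \<alpha> \<beta> = 0"
        using alg_independentD[OF ind, where s = s and c = "\<lambda>\<alpha>. c \<alpha> \<beta>"] \<alpha> by blast
    qed
  qed
  then show ?thesis using \<alpha>\<beta> by blast
qed

section \<open>Counting monomials with bounded exponents\<close>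

definition exponents_le :: "nat \<Rightarrow> ('a::zero, 'p) mpoly \<Rightarrow> bool" where
  "exponents_le s f \<longleftrightarrow> (\<forall>m\<in>Poly_Mapping.keys f. \<forall>i. Poly_Mapping.lookup m i \<le> s)"

lemma exponents_le_exists: "\<exists>s. exponents_le s (f :: ('a::zero, 'p::finite) mpoly)"
proof -
  have "exponents_le (\<Sum>m\<in>Poly_Mapping.keys f. \<Sum>i\<in>UNIV. Poly_Mapping.lookup m i) f"
    unfolding exponents_le_def
  proof (intro ballI allI)
    fix m i assume m: "m \<in> Poly_Mapping.keys f"
    have "Poly_Mapping.lookup m i \<le> (\<Sum>i\<in>UNIV. Poly_Mapping.lookup m i)"
      by (rule member_le_sum) auto
    also have "\<dots> \<le> (\<Sum>m\<in>Poly_Mapping.keys f. \<Sum>i\<in>UNIV. Poly_Mapping.lookup m i)"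
      by (rule member_le_sum) (use m in auto)
    finally show "Poly_Mapping.lookup m i \<le> \<dots>" .
  qed
  then show ?thesis ..
qed

lemma exponents_le_mono: "exponents_le s f \<Longrightarrow> s \<le> s' \<Longrightarrow> exponents_le s' f"
  by (meson exponents_le_def le_trans)

lemma exponents_le_mult:
  fixes f g :: "('a::comm_ring_1, 'p::finite) mpoly"
  assumes "exponents_le s f" "exponents_le s' g"
  shows "exponents_le (s + s') (f * g)"
  unfolding exponents_le_def
proof (intro ballI allI)
  fix m i assume "m \<in> Poly_Mapping.keys (f * g)"
  then obtain a b where "m = a + b" "a \<in> Poly_Mapping.keys f" "b \<in> Poly_Mapping.keys g"
    using keys_mult[of f g] by blast
  then show "Poly_Mapping.lookup m i \<le> s + s'"
    using assms by (auto simp: lookup_add exponents_le_def intro: add_mono)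
qed

lemma exponents_le_power:
  fixes f :: "('a::comm_ring_1, 'p::finite) mpoly"
  assumes "exponents_le s f"
  shows "exponents_le (n * s) (f ^ n)"
proof (induction n)
  case (Suc n)
  then show ?case using exponents_le_mult[OF assms Suc] by simp
qed (simp add: exponents_le_def)

lemma exponents_le_prod:
  fixes f :: "'i \<Rightarrow> ('a::comm_ring_1, 'p::finite) mpoly"
  assumes "\<And>a. a \<in> A \<Longrightarrow> exponents_le s (f a)"
  shows "exponents_le (card A * s) (prod f A)"
  using assms
proof (induction A rule: infinite_finite_induct)
  case (insert a A)
  then show ?case using exponents_le_mult[of s "f a" "card A * s" "prod f A"] by simp
qed (auto simp: exponents_le_def)

text \<open>The exponent bound leaves \<open>(s + 1) ^ CARD('p)\<close> monomials. More polynomials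
  than monomials satisfy a nontrivial linear relation between their coefficient vectors, which then
  holds at every point.\<close>

lemma independent_card_le:
  fixes q :: "'i \<Rightarrow> (complex, 'p::finite) mpoly"
  assumes "finite I" and q: "\<And>i. i \<in> I \<Longrightarrow> exponents_le s (q i)"
    and ind: "\<And>c. (\<And>x. (\<Sum>i\<in>I. c i * mpoly_eval (q i) (complex_vec x)) = 0) \<Longrightarrow> \<forall>i\<in>I. c i = 0"
  shows "card I \<le> (s + 1) ^ CARD('p)"
proof (rule ccontr)
  assume less: "\<not> ?thesis"
  define M where "M = {m :: 'p \<Rightarrow>\<^sub>0 nat. \<forall>i. Poly_Mapping.lookup m i \<le> s}"
  have M: "Poly_Mapping.lookup ` M \<subseteq> PiE UNIV (\<lambda>_. {..s})" "inj_on Poly_Mapping.lookup M"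
    by (auto simp: M_def inj_on_def poly_mapping_eqI)
  have finP: "finite (PiE (UNIV :: 'p set) (\<lambda>_. {..s}))"
    by (intro finite_PiE) auto
  have finM: "finite M"
    using finite_imageD[OF finite_subset[OF M(1) finP] M(2)] .
  have "card M \<le> card (PiE (UNIV :: 'p set) (\<lambda>_. {..s}))"
    using card_inj_on_le[OF M(2,1) finP] .
  also have "\<dots> = (s + 1) ^ CARD('p)" by (simp add: card_PiE)
  finally have "card M < card I" using less by simp
  then obtain c where c: "\<exists>i\<in>I. c i \<noteq> 0"
    and c0: "\<forall>m\<in>M. (\<Sum>i\<in>I. c i * Poly_Mapping.lookup (q i) m) = 0"
    using underdetermined_system[OF finM \<open>finite I\<close>, of "\<lambda>i m. Poly_Mapping.lookup (q i) m"] by blast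
  have "(\<Sum>i\<in>I. c i * mpoly_eval (q i) z) = 0" for z
  proof -
    have "(\<Sum>i\<in>I. c i * mpoly_eval (q i) z) =
        (\<Sum>i\<in>I. \<Sum>m\<in>M. c i * Poly_Mapping.lookup (q i) m * monom_eval m z)"
    proof (intro sum.cong refl)
      fix i assume "i \<in> I"
      then have "Poly_Mapping.keys (q i) \<subseteq> M" using q by (auto simp: M_def exponents_le_def)
      then show "c i * mpoly_eval (q i) z =
          (\<Sum>m\<in>M. c i * Poly_Mapping.lookup (q i) m * monom_eval m z)"
        by (simp add: mpoly_eval_eq_sum[OF finM] sum_distrib_left mult_ac)
    qed
    also have "\<dots> = (\<Sum>m\<in>M. (\<Sum>i\<in>I. c i * Poly_Mapping.lookup (q i) m) * monom_eval m z)"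
      by (subst sum.swap) (simp add: sum_distrib_right)
    also have "\<dots> = 0" using c0 by simp
    finally show ?thesis .
  qed
  then show False using ind[of c] c by blast
qed

text \<open>If \<open>n > p\<close>, the left side has an extra factor \<open>s + 1\<close>, which
  beats the constant \<open>C ^ p\<close> already for \<open>s = C ^ p\<close>.\<close>

lemma exponent_le_of_power_growth:
  fixes C n p :: nat
  assumes "\<And>s. (s + 1) ^ n \<le> (C * (s + 1)) ^ p"
  shows "n \<le> p"
proof (rule ccontr)
  assume "\<not> n \<le> p"
  define s where "s = C ^ p"
  have "(s + 1) ^ p * (s + 1) \<le> (s + 1) ^ n"
    using \<open>\<not> n \<le> p\<close> power_increasing[of "Suc p" n "s + 1"] by (simp add: mult_ac)
  also have "\<dots> \<le> s * (s + 1) ^ p"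
    using assms[of s] unfolding power_mult_distrib s_def .
  finally show False by simp
qed

lemma alg_independent_card_bound:
  fixes V :: "(real ^ 'p::finite) set" and t :: "'i \<Rightarrow> (complex, 'p) mpoly"
    and g :: "'b \<Rightarrow> (real, 'p) mpoly"
  assumes irr: "irreducible_set V" and ind: "alg_independent (complex_vec ` V) A t"
    and fin: "finite A" "finite B"
    and gV: "\<And>b x. b \<in> B \<Longrightarrow> x \<in> V \<Longrightarrow> mpoly_eval (g b) x = 0"
    and D: "x0 \<in> V" "mpoly_eval D x0 \<noteq> 0"
    and surj: "\<And>x y. x \<in> V \<Longrightarrow> mpoly_eval D x \<noteq> 0 \<Longrightarrow> \<exists>v. \<forall>b\<in>B. mpoly_grad (g b) x \<bullet> v = y b"
  shows "card A + card B \<le> CARD('p)"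
proof -
  have "\<forall>i. \<exists>s. exponents_le s (t i)" "\<forall>b. \<exists>s. exponents_le s (complex_mpoly (g b))"
    using exponents_le_exists by blast+
  then obtain et eg where et: "\<And>i. exponents_le (et i) (t i)"
    and eg: "\<And>b. exponents_le (eg b) (complex_mpoly (g b))"
    by metis
  define e where "e = sum et A + sum eg B"
  have et: "exponents_le e (t i)" if "i \<in> A" for i
    using exponents_le_mono[OF et[of i]] member_le_sum[of i A et] that fin
    by (auto simp: e_def trans_le_add1)
  have eg: "exponents_le e (complex_mpoly (g b))" if "b \<in> B" for b
    using exponents_le_mono[OF eg[of b]] member_le_sum[of b B eg] that fin
    by (auto simp: e_def trans_le_add2)
  \<comment> \<open>A product of \<open>card A + card B\<close> powers, each at most the
    \<open>s\<close>-th, has exponents at most \<open>(card A + card B) * s * e\<close>. Counting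
    the exponent 0 as well, each variable has at most \<open>C * (s + 1)\<close> admissible
    exponents.\<close>
  define C where "C = (card A + card B) * e + 1"
  have "(s + 1) ^ (card A + card B) \<le> (C * (s + 1)) ^ CARD('p)" for s
  proof -
    let ?A = "PiE A (\<lambda>_. {..s :: nat})" and ?B = "PiE B (\<lambda>_. {..s :: nat})"
    define q where "q = (\<lambda>(\<beta>, \<alpha>). (\<Prod>i\<in>A. t i ^ \<alpha> i) * (\<Prod>b\<in>B. complex_mpoly (g b) ^ \<beta> b))"
    have finAB: "finite ?A" "finite ?B" using fin by (auto intro: finite_PiE)
    have "card (?B \<times> ?A) \<le> (card A * (s * e) + card B * (s * e) + 1) ^ CARD('p)"
    proof (rule independent_card_le)
      show "finite (?B \<times> ?A)" using finAB by simp
      show "exponents_le (card A * (s * e) + card B * (s * e)) (q i)" if mem: "i \<in> ?B \<times> ?A" for i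
      proof -
        obtain \<alpha> \<beta> where i: "i = (\<beta>, \<alpha>)" "\<alpha> \<in> ?A" "\<beta> \<in> ?B" using mem by blast
        have "exponents_le (s * e) (t k ^ \<alpha> k)" if "k \<in> A" for k
          using exponents_le_mono[OF exponents_le_power[OF et[OF that]]] i that
          by (meson PiE_mem atMost_iff mult_le_mono1)
        moreover have "exponents_le (s * e) (complex_mpoly (g b) ^ \<beta> b)" if "b \<in> B" for b
          using exponents_le_mono[OF exponents_le_power[OF eg[OF that]]] i that
          by (meson PiE_mem atMost_iff mult_le_mono1)
        ultimately show ?thesis
          unfolding q_def i by (auto intro!: exponents_le_mult exponents_le_prod)
      qed
      show "\<forall>i\<in>?B \<times> ?A. c i = 0"
        if "\<And>x. (\<Sum>i\<in>?B \<times> ?A. c i * mpoly_eval (q i) (complex_vec x)) = 0" for c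
      proof -
        have "(\<Sum>\<beta>\<in>?B. \<Sum>\<alpha>\<in>?A. c (\<beta>, \<alpha>) *
          ((\<Prod>i\<in>A. mpoly_eval (t i) (complex_vec x) ^ \<alpha> i) *
           (\<Prod>b\<in>B. of_real (mpoly_eval (g b) x) ^ \<beta> b))) = 0" for x
          using that[of x]
          by (simp add: q_def sum.cartesian_product case_prod_unfold mpoly_eval_complex_mpoly)
        then show ?thesis
          using alg_independent_with_equations[OF irr ind fin gV D surj, where c = "\<lambda>\<alpha> \<beta>. c (\<beta>, \<alpha>)"]
          by blast
      qed
    qed
    also have "card (?B \<times> ?A) = (s + 1) ^ (card A + card B)"
      using fin by (simp add: card_PiE card_cartesian_product power_add)
    also have "(card A * (s * e) + card B * (s * e) + 1) ^ CARD('p) \<le> (C * (s + 1)) ^ CARD('p)"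
      by (intro power_mono) (auto simp: C_def algebra_simps)
    finally show ?thesis .
  qed
  then show ?thesis
    by (rule exponent_le_of_power_growth)
qed

subsection \<open>Real gradients at smooth points\<close>

text \<open>The conormal space at \<open>x\<close>, formed from the whole real ideal so that no
  generators have to be chosen.\<close>

definition gradients :: "(real ^ 'p::finite) set \<Rightarrow> real ^ 'p \<Rightarrow> (real ^ 'p) set" where
  "gradients V x = (\<lambda>f. mpoly_grad f x) ` vanishing_ideal V"

lemma complex_mpoly_vanishing:
  "f \<in> vanishing_ideal V \<Longrightarrow> complex_mpoly f \<in> vanishing_ideal (complexification V)"
  using zero_on_complexification[of V "complex_mpoly f"]
  by (auto simp: vanishing_ideal_def mpoly_eval_complex_mpoly)

lemma Re_Im_vanishing:
  assumes "f \<in> vanishing_ideal (complexification V)"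
  shows "mpoly_Re f \<in> vanishing_ideal V" "mpoly_Im f \<in> vanishing_ideal V"
  using assms complex_vec_in_complexification[of _ V]
  by (auto simp: vanishing_ideal_def mpoly_eval_Re mpoly_eval_Im)

lemma complex_vec_simps [simp]:
  "complex_vec 0 = 0" "complex_vec (x + y) = complex_vec x + complex_vec y"
  "complex_vec (c *\<^sub>R x) = complex_of_real c *s complex_vec x"
  by (auto simp: complex_vec_def vec_eq_iff)

lemma inj_complex_vec: "inj complex_vec"
  by (auto simp: inj_def complex_vec_def vec_eq_iff)

lemma complex_vec_span: "v \<in> span S \<Longrightarrow> complex_vec v \<in> vec.span (complex_vec ` S)"
proof (induction rule: span_induct_alt)
  case base
  then show ?case by (simp add: vec.span_zero)
next
  case (step c x y)
  then show ?case by (simp add: vec.span_add vec.span_scale vec.span_base)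
qed

text \<open>Real and imaginary parts of a complex relation are relations over the reals.\<close>

lemma independent_complex_vec:
  assumes "independent B"
  shows "vec.independent (complex_vec ` B)"
proof -
  have fin: "finite B" using assms independent_imp_finite by blast
  have "u v = 0" if "(\<Sum>v\<in>complex_vec ` B. u v *s v) = 0" "v \<in> complex_vec ` B" for u v
  proof -
    have *: "(\<Sum>b\<in>B. u (complex_vec b) *s complex_vec b) = 0"
      using that(1) sum.reindex[OF inj_on_subset[OF inj_complex_vec subset_UNIV], of "\<lambda>v. u v *s v" B] by (simp add: o_def)
    have "(\<Sum>b\<in>B. Re (u (complex_vec b)) *\<^sub>R b) = 0" "(\<Sum>b\<in>B. Im (u (complex_vec b)) *\<^sub>R b) = 0"
    proof -
      have "(\<Sum>b\<in>B. u (complex_vec b) * of_real (b $ i)) = 0" for i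
        using arg_cong[OF *, of "\<lambda>w. w $ i"] by (simp add: complex_vec_def)
      then have "Re (\<Sum>b\<in>B. u (complex_vec b) * of_real (b $ i)) = 0"
        "Im (\<Sum>b\<in>B. u (complex_vec b) * of_real (b $ i)) = 0" for i by simp_all
      then show "(\<Sum>b\<in>B. Re (u (complex_vec b)) *\<^sub>R b) = 0" "(\<Sum>b\<in>B. Im (u (complex_vec b)) *\<^sub>R b) = 0"
        by (simp_all add: vec_eq_iff)
    qed
    then have "Re (u (complex_vec b)) = 0 \<and> Im (u (complex_vec b)) = 0" if "b \<in> B" for b
      using real_vector.independentD[OF assms fin order_refl] that by auto
    then show ?thesis using that(2) by (auto simp: complex_eq_iff)
  qed
  then show ?thesis
    unfolding vec.dependent_finite[OF finite_imageI[OF fin]] by metis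
qed

lemma generates_ideal_subset:
  assumes "generates_ideal G I"
  shows "G \<subseteq> I"
proof
  fix g0 assume g0: "g0 \<in> G"
  have G: "finite G" "I = {(\<Sum>g\<in>G. h g * g) | h. True}"
    using assms by (auto simp: generates_ideal_def)
  have "(\<Sum>g\<in>G. (if g = g0 then 1 else 0) * g) = (\<Sum>g\<in>G. if g = g0 then g else 0)"
    by (intro sum.cong) auto
  also have "\<dots> = g0"
    using G(1) g0 by (simp add: sum.delta')
  finally have "g0 = (\<Sum>g\<in>G. (if g = g0 then 1 else 0) * g)" ..
  then show "g0 \<in> I"
    unfolding G(2) mem_Collect_eq
    by (intro exI[of _ "\<lambda>g. if g = g0 then 1 else 0"] conjI TrueI)
qed

text \<open>Both sides span the same complex space. A generator splits into real and imaginary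
  parts, which lie in the real ideal; conversely a real polynomial vanishing on \<open>V\<close> is
  a combination of the generators, and at a point of \<open>V\<close> so is its gradient.\<close>

lemma jacobian_rank_eq_dim_gradients:
  assumes x: "x \<in> V" and gen: "generates_ideal G (vanishing_ideal (complexification V))"
  shows "jacobian_rank G (complex_vec x) = dim (gradients V x)"
proof -
  let ?z = "complex_vec x"
  have G: "finite G" "vanishing_ideal (complexification V) = {(\<Sum>g\<in>G. h g * g) | h. True}"
    using gen by (auto simp: generates_ideal_def)
  have sub: "G \<subseteq> vanishing_ideal (complexification V)"
    using generates_ideal_subset[OF gen] .
  obtain B where B: "B \<subseteq> gradients V x" "independent B" "gradients V x \<subseteq> span B"
    "card B = dim (gradients V x)"
    using basis_exists by blast
  have eval0: "mpoly_eval g ?z = 0" if "g \<in> G" for g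
    using that sub complex_vec_in_complexification[OF x] by (auto simp: vanishing_ideal_def)
  have "vec.span ((\<lambda>g. mpoly_grad g ?z) ` G) = vec.span (complex_vec ` B)"
  proof (rule vec.span_eq[THEN iffD2], intro conjI subsetI)
    fix w assume "w \<in> (\<lambda>g. mpoly_grad g ?z) ` G"
    then obtain g where g: "g \<in> G" "w = mpoly_grad g ?z" by blast
    have "mpoly_grad (mpoly_Re g) x \<in> span B" "mpoly_grad (mpoly_Im g) x \<in> span B"
      using Re_Im_vanishing[of g V] sub g(1) B(3) by (auto simp: gradients_def)
    then show "w \<in> vec.span (complex_vec ` B)"
      unfolding g(2) mpoly_grad_Re_Im by (intro vec.span_add vec.span_scale complex_vec_span)
  next
    fix w assume "w \<in> complex_vec ` B"
    then obtain f where f: "f \<in> vanishing_ideal V" "w = complex_vec (mpoly_grad f x)"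
      using B(1) by (auto simp: gradients_def)
    obtain h where h: "complex_mpoly f = (\<Sum>g\<in>G. h g * g)"
      using complex_mpoly_vanishing[OF f(1)] unfolding G(2) by blast
    have "w = mpoly_grad (\<Sum>g\<in>G. h g * g) ?z"
      by (simp add: f(2) mpoly_grad_complex_mpoly flip: h)
    also have "\<dots> = (\<Sum>g\<in>G. mpoly_eval (h g) ?z *s mpoly_grad g ?z)"
      by (rule mpoly_grad_combination) (rule eval0)
    also have "\<dots> \<in> vec.span ((\<lambda>g. mpoly_grad g ?z) ` G)"
      by (intro vec.span_sum vec.span_scale vec.span_base) auto
    finally show "w \<in> vec.span ((\<lambda>g. mpoly_grad g ?z) ` G)" .
  qed
  then have "vec.dim ((\<lambda>g. mpoly_grad g ?z) ` G) = vec.dim (complex_vec ` B)"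
    by (metis vec.dim_span)
  also have "\<dots> = card (complex_vec ` B)"
    by (rule vec.dim_eq_card_independent) (rule independent_complex_vec[OF B(2)])
  also have "\<dots> = card B"
    by (rule card_image) (rule inj_on_subset[OF inj_complex_vec subset_UNIV])
  finally show ?thesis
    by (simp add: jacobian_rank_def mpoly_grad_def[abs_def] B(4))
qed

text \<open>Smoothness in terms of real gradients. The generators that witness smoothness of
  \<open>x0\<close> also serve for \<open>y\<close>: a rank at \<open>y\<close> not below the
  maximum attained at \<open>x0\<close> is itself maximal.\<close>

lemma smooth_point_dim_gradients:
  assumes "x0 \<in> smooth_points V" "y \<in> V"
  shows "dim (gradients V y) \<le> dim (gradients V x0)"
    and "dim (gradients V x0) \<le> dim (gradients V y) \<Longrightarrow> y \<in> smooth_points V"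
proof -
  obtain G where G: "x0 \<in> V" "generates_ideal G (vanishing_ideal (complexification V))"
    "\<forall>z\<in>complexification V. jacobian_rank G z \<le> jacobian_rank G (complex_vec x0)"
    using assms(1) by (auto simp: smooth_points_def)
  note eq = jacobian_rank_eq_dim_gradients[OF G(1,2)] jacobian_rank_eq_dim_gradients[OF assms(2) G(2)]
  show "dim (gradients V y) \<le> dim (gradients V x0)"
    using bspec[OF G(3) complex_vec_in_complexification[OF assms(2)]] by (simp add: eq)
  show "y \<in> smooth_points V" if "dim (gradients V x0) \<le> dim (gradients V y)"
    unfolding smooth_points_def
  proof (intro CollectI conjI exI[of _ G] ballI)
    fix z assume "z \<in> complexification V"
    then show "jacobian_rank G z \<le> jacobian_rank G (complex_vec y)"
      using bspec[OF G(3), of z] that by (simp add: eq)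
  qed (use assms G in auto)
qed

text \<open>\<open>R\<close> consists of the real and imaginary parts of complex generators. Ideal
  membership is turned into an estimate with a continuous coefficient, the form that a differential
  inequality for the equations requires.\<close>

lemma finite_equations:
  assumes "real_variety V" "x0 \<in> smooth_points V"
  obtains R where "finite R" "R \<subseteq> vanishing_ideal V"
    "\<And>f. f \<in> vanishing_ideal V \<Longrightarrow> \<exists>c. continuous_on UNIV c \<and>
       (\<forall>y. \<bar>mpoly_eval f y\<bar> \<le> c y * (\<Sum>\<rho>\<in>R. \<bar>mpoly_eval \<rho> y\<bar>))"
    "\<And>y. (\<And>\<rho>. \<rho> \<in> R \<Longrightarrow> mpoly_eval \<rho> y = 0) \<Longrightarrow> y \<in> V"
proof -
  obtain G where gen: "generates_ideal G (vanishing_ideal (complexification V))"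
    using assms(2) by (auto simp: smooth_points_def)
  have G: "finite G" "vanishing_ideal (complexification V) = {(\<Sum>g\<in>G. h g * g) | h. True}"
    using gen by (auto simp: generates_ideal_def)
  have sub: "G \<subseteq> vanishing_ideal (complexification V)"
    using generates_ideal_subset[OF gen] .
  define R where "R = mpoly_Re ` G \<union> mpoly_Im ` G"
  have R: "finite R" "R \<subseteq> vanishing_ideal V"
    using G(1) sub Re_Im_vanishing[of _ V] by (auto simp: R_def)
  have bound: "\<exists>c. continuous_on UNIV c \<and>
       (\<forall>y. \<bar>mpoly_eval f y\<bar> \<le> c y * (\<Sum>\<rho>\<in>R. \<bar>mpoly_eval \<rho> y\<bar>))" if f: "f \<in> vanishing_ideal V" for f
  proof -
    obtain h where h: "complex_mpoly f = (\<Sum>g\<in>G. h g * g)"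
      using complex_mpoly_vanishing[OF f] unfolding G(2) by blast
    \<comment> \<open>The factor 2 arises because the real and the imaginary part of
      \<open>g\<close> are each estimated by the whole sum over \<open>R\<close>.\<close>
    define c where "c y = (\<Sum>g\<in>G. 2 * cmod (mpoly_eval (h g) (complex_vec y)))" for y
    have "continuous_on UNIV c"
      unfolding c_def complex_vec_def
      by (intro continuous_intros continuous_on_compose2[OF continuous_on_mpoly_eval[of UNIV]]) auto
    moreover have "\<bar>mpoly_eval f y\<bar> \<le> c y * (\<Sum>\<rho>\<in>R. \<bar>mpoly_eval \<rho> y\<bar>)" for y
    proof -
      let ?S = "\<Sum>\<rho>\<in>R. \<bar>mpoly_eval \<rho> y\<bar>"
      have "\<bar>mpoly_eval f y\<bar> = cmod (mpoly_eval (complex_mpoly f) (complex_vec y))"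
        by (simp add: mpoly_eval_complex_mpoly)
      also have "\<dots> \<le> (\<Sum>g\<in>G. cmod (mpoly_eval (h g) (complex_vec y)) * cmod (mpoly_eval g (complex_vec y)))"
        unfolding h mpoly_eval_sum mpoly_eval_mult norm_mult[symmetric] by (rule norm_sum)
      also have "\<dots> \<le> (\<Sum>g\<in>G. cmod (mpoly_eval (h g) (complex_vec y)) * (2 * ?S))"
      proof (intro sum_mono mult_left_mono)
        fix g assume g: "g \<in> G"
        have "cmod (mpoly_eval g (complex_vec y)) \<le> \<bar>mpoly_eval (mpoly_Re g) y\<bar> + \<bar>mpoly_eval (mpoly_Im g) y\<bar>"
          by (simp add: mpoly_eval_Re mpoly_eval_Im cmod_le)
        also have "\<dots> \<le> ?S + ?S"
          by (intro add_mono member_le_sum[where f = "\<lambda>\<rho>. \<bar>mpoly_eval \<rho> y\<bar>"]) (use R g in \<open>auto simp: R_def\<close>)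
        finally show "cmod (mpoly_eval g (complex_vec y)) \<le> 2 * ?S" by simp
      qed simp
      also have "\<dots> = c y * ?S"
        unfolding c_def sum_distrib_right by (intro sum.cong) auto
      finally show ?thesis .
    qed
    ultimately show ?thesis by blast
  qed
  have "y \<in> V" if y: "\<And>\<rho>. \<rho> \<in> R \<Longrightarrow> mpoly_eval \<rho> y = 0" for y
  proof -
    have "(\<Sum>\<rho>\<in>R. \<bar>mpoly_eval \<rho> y\<bar>) = 0" using y by simp
    then have van: "mpoly_eval f y = 0" if "f \<in> vanishing_ideal V" for f
      using bound[OF that] by (metis abs_le_zero_iff mult_zero_right)
    \<comment> \<open>The equations of the complex variety have real coefficients and vanish on
      \<open>V\<close>; they belong to the real ideal and hence vanish at \<open>y\<close>.\<close>
    obtain F :: "(real, 'a) mpoly set" where F: "complexification V = zero_set (complex_mpoly ` F)"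
      using assms(1) by (auto simp: real_variety_def)
    have "mpoly_eval f x = 0" if "f \<in> F" "x \<in> V" for f x
      using complex_vec_in_complexification[OF that(2)] that(1) unfolding F
      by (auto simp: zero_set_def mpoly_eval_complex_mpoly)
    then have "complex_vec y \<in> complexification V"
      using van unfolding F by (auto simp: zero_set_def mpoly_eval_complex_mpoly vanishing_ideal_def)
    then show ?thesis using assms(1) by (auto simp: real_variety_def)
  qed
  then show ?thesis using that R bound by blast
qed

subsection \<open>A chart at a smooth point\<close>

text \<open>\<open>exp (- K * t) * E t\<close> is nonincreasing and starts at zero. With
  \<open>E\<close> measuring the failure of equations, this carries a solution along a
  curve.\<close>

lemma gronwall_zero:
  fixes E :: "real \<Rightarrow> real"
  assumes der: "\<And>t. t \<in> {0..1} \<Longrightarrow> (E has_real_derivative E' t) (at t)"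
    and bound: "\<And>t. t \<in> {0..1} \<Longrightarrow> E' t \<le> K * E t"
    and "E 0 = 0" "0 \<le> E 1"
  shows "E 1 = 0"
proof -
  have "exp (- K * 1) * E 1 \<le> exp (- K * 0) * E 0"
  proof (rule DERIV_nonpos_imp_nonincreasing[where f = "\<lambda>t. exp (- K * t) * E t"])
    fix t :: real assume t: "0 \<le> t" "t \<le> 1"
    have "((\<lambda>t. exp (- K * t) * E t) has_real_derivative exp (- K * t) * (E' t - K * E t)) (at t)"
      using t by (auto intro!: derivative_eq_intros der simp: algebra_simps)
    moreover have "exp (- K * t) * (E' t - K * E t) \<le> 0"
      using bound[of t] t by (simp add: mult_nonneg_nonpos)
    ultimately show "\<exists>y. ((\<lambda>t. exp (- K * t) * E t) has_real_derivative y) (at t) \<and> y \<le> 0" by blast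
  qed simp
  then show ?thesis using assms(3,4) by (simp add: mult_le_0_iff)
qed

text \<open>\<open>B\<close> is a basis of the conormal space at \<open>x0\<close>, the
  \<open>g b\<close> are equations with these gradients, and \<open>P\<close> is the orthogonal
  projection onto the complement of \<open>span B\<close>, the tangent space. \<open>dim_le\<close>
  expresses that the rank is maximal at \<open>x0\<close>.\<close>

locale smooth_frame =
  fixes V :: "(real ^ 'p::finite) set" and x0 :: "real ^ 'p" and B :: "(real ^ 'p) set"
    and g :: "real ^ 'p \<Rightarrow> (real, 'p) mpoly" and P :: "real ^ 'p \<Rightarrow> real ^ 'p"
  assumes x0: "x0 \<in> V" and indep: "independent B"
    and gI: "\<And>b. b \<in> B \<Longrightarrow> g b \<in> vanishing_ideal V"
    and grad_g: "\<And>b. b \<in> B \<Longrightarrow> mpoly_grad (g b) x0 = b"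
    and dim_le: "\<And>y. y \<in> V \<Longrightarrow> dim (gradients V y) \<le> card B"
    and linP: "linear P" and P_orth: "\<And>v b. b \<in> B \<Longrightarrow> b \<bullet> P v = 0"
    and P_span: "\<And>v. v - P v \<in> span B"
begin

lemma finB: "finite B" using indep independent_imp_finite by blast

lemma orth_span: "(\<And>b. b \<in> B \<Longrightarrow> b \<bullet> v = 0) \<Longrightarrow> u \<in> span B \<Longrightarrow> u \<bullet> v = 0"
  using orthogonal_to_span[of u B v] by (auto simp: orthogonal_def inner_commute)

lemma orth_in_span_zero: "(\<And>b. b \<in> B \<Longrightarrow> b \<bullet> v = 0) \<Longrightarrow> v \<in> span B \<Longrightarrow> v = 0"
  using orth_span[of v v] by simp

lemma P_fixed:
  assumes "\<And>b. b \<in> B \<Longrightarrow> b \<bullet> v = 0"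
  shows "P v = v"
proof -
  have "v - P v = 0"
    by (rule orth_in_span_zero) (use assms P_orth P_span in \<open>auto simp: inner_diff_right\<close>)
  then show ?thesis by simp
qed

lemma P_P: "P (P v) = P v" by (rule P_fixed) (rule P_orth)

lemma norm_P_le: "norm (P v) \<le> norm v"
proof -
  have "(v - P v) \<bullet> P v = 0" by (rule orth_span) (use P_orth P_span in auto)
  then have "(norm (P v))\<^sup>2 = v \<bullet> P v"
    by (simp add: power2_norm_eq_inner inner_diff_left)
  also have "\<dots> \<le> norm v * norm (P v)" by (rule norm_cauchy_schwarz)
  finally show ?thesis
    by (cases "P v = 0") (auto simp: power2_eq_square)
qed

lemma P_diff: "P (u - v) = P u - P v" by (rule linear_diff[OF linP])
lemma P_add: "P (u + v) = P u + P v" by (rule linear_add[OF linP])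

lemma dim_range_P: "CARD('p) - card B \<le> dim (range P)"
proof -
  have "subspace (range P)" using linP by (rule linear_subspace_image) simp
  have "UNIV = {x + y |x y. x \<in> range P \<and> y \<in> span B}"
  proof (intro set_eqI iffI UNIV_I)
    fix v show "v \<in> {x + y |x y. x \<in> range P \<and> y \<in> span B}"
      using P_span[of v] by (intro CollectI exI[of _ "P v"] exI[of _ "v - P v"]) auto
  qed
  then have "dim (UNIV :: (real ^ 'p) set) + dim (range P \<inter> span B) = dim (range P) + dim (span B)"
    using dim_sums_Int[OF \<open>subspace (range P)\<close> subspace_span, of B] by simp
  moreover have "dim (span B) = card B" by (simp add: dim_eq_card_independent indep)
  ultimately show ?thesis by (simp add: DIM_cart)
qed

text \<open>Coordinates that straighten \<open>V\<close>: the tangential position, and the values of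
  the equations as coefficients with respect to \<open>B\<close>. On \<open>V\<close> the second
  part is zero.\<close>

definition Phi :: "real ^ 'p \<Rightarrow> real ^ 'p" where
  "Phi y = P (y - x0) + (\<Sum>b\<in>B. mpoly_eval (g b) y *\<^sub>R b)"

definition Phi' :: "real ^ 'p \<Rightarrow> real ^ 'p \<Rightarrow> real ^ 'p" where
  "Phi' y v = P v + (\<Sum>b\<in>B. (mpoly_grad (g b) y \<bullet> v) *\<^sub>R b)"

lemma linear_Phi': "linear (Phi' y)"
  unfolding Phi'_def
  by (intro linear_compose_add linP linear_compose_sum ballI linearI)
    (auto simp: inner_add_right algebra_simps)

lemma has_derivative_Phi: "(Phi has_derivative Phi' y) (at y)"
proof -
  have "bounded_linear P" using linP linear_conv_bounded_linear by blast
  then have "((\<lambda>y. P (y - x0) + (\<Sum>b\<in>B. mpoly_eval (g b) y *\<^sub>R b)) has_derivative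
      (\<lambda>v. P (v - 0) + (\<Sum>b\<in>B. (mpoly_grad (g b) y \<bullet> v) *\<^sub>R b))) (at y)"
    by (intro has_derivative_add has_derivative_sum has_derivative_scaleR_left
        has_derivative_mpoly_eval_real bounded_linear.has_derivative[of P] has_derivative_diff
        has_derivative_ident has_derivative_const)
  then show ?thesis by (simp add: Phi_def[abs_def] Phi'_def[abs_def])
qed

lemma Phi'_components:
  assumes "Phi' y v = w + (\<Sum>b\<in>B. z b *\<^sub>R b)" "\<And>b. b \<in> B \<Longrightarrow> b \<bullet> w = 0"
  shows "P v = w" "b \<in> B \<Longrightarrow> mpoly_grad (g b) y \<bullet> v = z b"
proof -
  have eq: "P v - w = (\<Sum>b\<in>B. (z b - mpoly_grad (g b) y \<bullet> v) *\<^sub>R b)"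
    using assms(1) by (simp add: Phi'_def scaleR_left_diff_distrib sum_subtractf algebra_simps)
  have "P v - w = 0"
  proof (rule orth_in_span_zero)
    show "P v - w \<in> span B" unfolding eq by (intro span_sum span_scale span_base)
  qed (use assms(2) P_orth in \<open>auto simp: inner_diff_right\<close>)
  then show "P v = w" by simp
  show "mpoly_grad (g b) y \<bullet> v = z b" if "b \<in> B"
    using real_vector.independentD[OF indep finB order_refl, of "\<lambda>b. z b - mpoly_grad (g b) y \<bullet> v"]
      eq \<open>P v - w = 0\<close> that by auto
qed

text \<open>Where this polynomial is nonzero, the gradients of the \<open>g b\<close> are
  independent. It also plays the role of \<open>D\<close> in the counting argument.\<close>

definition Jac :: "real ^ 'p \<Rightarrow> real" where
  "Jac y = det (matrix (Phi' y))"

lemma Jac_nonzero_iff: "Jac y \<noteq> 0 \<longleftrightarrow> inj (Phi' y)"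
  unfolding Jac_def using det_nz_iff_inj[OF linear_Phi'] .

lemma bij_Phi': "Jac y \<noteq> 0 \<Longrightarrow> bij (Phi' y)"
  using Jac_nonzero_iff linear_inj_imp_surj[OF linear_Phi'] by (auto simp: bij_def)

lemma polynomial_grad: "polynomial_fun (\<lambda>y. mpoly_grad f y $ i)"
  by (simp add: mpoly_grad_def)

lemma polynomial_Phi'_entry: "polynomial_fun (\<lambda>y. Phi' y v $ i)"
proof -
  have "polynomial_fun (\<lambda>y. P v $ i + (\<Sum>b\<in>B. (\<Sum>j\<in>UNIV. mpoly_grad (g b) y $ j * v $ j) * b $ i))"
    by (intro polynomial_fun_add polynomial_fun_sum polynomial_fun_mult polynomial_fun_const polynomial_grad)
  then show ?thesis by (simp add: Phi'_def inner_vec_def)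
qed

lemma polynomial_Jac: "polynomial_fun Jac"
  unfolding Jac_def[abs_def]
  by (rule polynomial_fun_det) (simp add: matrix_def polynomial_Phi'_entry)

lemma Jac_x0: "Jac x0 \<noteq> 0"
  unfolding Jac_nonzero_iff linear_injective_0[OF linear_Phi']
proof (intro allI impI)
  fix v assume "Phi' x0 v = 0"
  then have "Phi' x0 v = 0 + (\<Sum>b\<in>B. 0 *\<^sub>R b)" by simp
  from Phi'_components[OF this] have "P v = 0" "\<And>b. b \<in> B \<Longrightarrow> b \<bullet> v = 0"
    using grad_g by auto
  then show "v = 0" using P_fixed[of v] by simp
qed

lemma gradients_surj:
  assumes "Jac y \<noteq> 0"
  shows "\<exists>v. \<forall>b\<in>B. mpoly_grad (g b) y \<bullet> v = z b"
proof -
  obtain v where "Phi' y v = 0 + (\<Sum>b\<in>B. z b *\<^sub>R b)"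
    using bij_Phi'[OF assms] by (metis bij_pointE)
  from Phi'_components(2)[OF this] show ?thesis by auto
qed

text \<open>Dual vectors show that the gradients of the \<open>g b\<close> at \<open>y\<close> are
  \<open>card B\<close> independent vectors; as no conormal space at a point of \<open>V\<close> is
  larger, they span.\<close>

lemma span_gradients:
  assumes y: "y \<in> V" "Jac y \<noteq> 0"
  shows "span (gradients V y) = span ((\<lambda>b. mpoly_grad (g b) y) ` B)"
    and "dim (gradients V y) = card B"
proof -
  let ?h = "\<lambda>b. mpoly_grad (g b) y"
  have dual: "\<exists>v. \<forall>b\<in>B. ?h b \<bullet> v = (if b = b0 then 1 else 0)" for b0
    using gradients_surj[OF y(2), of "\<lambda>b. if b = b0 then 1 else 0"] .
  have inj: "inj_on ?h B"
  proof (rule inj_onI)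
    fix b b' assume "b \<in> B" "b' \<in> B" "?h b = ?h b'"
    with dual[of b] show "b = b'" by (metis zero_neq_one)
  qed
  have u0: "u (?h b0) = 0" if s: "(\<Sum>b\<in>B. u (?h b) *\<^sub>R ?h b) = 0" and b0: "b0 \<in> B" for u b0
  proof -
    obtain v where v: "\<forall>b\<in>B. ?h b \<bullet> v = (if b = b0 then 1 else 0)" using dual by blast
    have "0 = (\<Sum>b\<in>B. u (?h b) *\<^sub>R ?h b) \<bullet> v" using s by simp
    also have "\<dots> = (\<Sum>b\<in>B. if b = b0 then u (?h b) else 0)"
      unfolding inner_sum_left by (intro sum.cong) (auto simp: v)
    also have "\<dots> = u (?h b0)" using b0 finB by simp
    finally show "u (?h b0) = 0" by simp
  qed
  have "independent (?h ` B)"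
    unfolding real_vector.dependent_finite[OF finite_imageI[OF finB]]
    using u0 by (auto simp: sum.reindex[OF inj] o_def)
  then have dimS: "dim (span (?h ` B)) = card B"
    by (simp add: dim_eq_card_independent card_image[OF inj])
  have sub: "span (?h ` B) \<subseteq> span (gradients V y)"
    by (intro span_mono) (auto simp: gradients_def gI)
  have "dim (span (gradients V y)) \<le> dim (span (?h ` B))"
    using dim_le[OF y(1)] dimS by simp
  then show eq: "span (gradients V y) = span (?h ` B)"
    using subspace_dim_equal[OF subspace_span subspace_span sub] by simp
  show "dim (gradients V y) = card B"
    using dimS eq by (metis dim_span)
qed

text \<open>By Cramer's rule the vector fields \<open>inv (Phi' y) w\<close> with \<open>w\<close> orthogonal to \<open>B\<close> become
  polynomial after multiplication by \<open>Jac y\<close>. Since they are tangent to \<open>V\<close>, the derivatives along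
  them of polynomials vanishing on \<open>V\<close> again vanish on \<open>V\<close>.\<close>

lemma tangential_derivative_vanishing:
  assumes f: "f \<in> vanishing_ideal V" and w: "\<And>b. b \<in> B \<Longrightarrow> b \<bullet> w = 0"
  shows "\<exists>q\<in>vanishing_ideal V. \<forall>y v. Jac y \<noteq> 0 \<longrightarrow> Phi' y v = w \<longrightarrow>
    mpoly_eval q y = (Jac y)\<^sup>2 * (mpoly_grad f y \<bullet> v)"
proof -
  define A where "A k y = (\<chi> i j. if j = k then w $ i else matrix (Phi' y) $ i $ j)" for k y
  have "polynomial_fun (\<lambda>y. Jac y * (\<Sum>k\<in>UNIV. mpoly_grad f y $ k * det (A k y)))"
  proof (intro polynomial_fun_mult polynomial_Jac polynomial_fun_sum polynomial_grad polynomial_fun_det)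
    fix k i j show "polynomial_fun (\<lambda>y. A k y $ i $ j)"
      by (cases "j = k") (auto simp: A_def matrix_def polynomial_Phi'_entry)
  qed
  then obtain q where "mpoly_eval q = (\<lambda>y. Jac y * (\<Sum>k\<in>UNIV. mpoly_grad f y $ k * det (A k y)))"
    unfolding polynomial_fun_def by metis
  then have q: "mpoly_eval q y = Jac y * (\<Sum>k\<in>UNIV. mpoly_grad f y $ k * det (A k y))" for y
    by simp
  have eq: "mpoly_eval q y = (Jac y)\<^sup>2 * (mpoly_grad f y \<bullet> v)" if "Jac y \<noteq> 0" "Phi' y v = w" for y v
  proof -
    have "matrix (Phi' y) *v v = w"
      using that(2) matrix_works[of "Phi' y" v] linear_Phi' by (simp add: linear_matrix_vector_mul_eq)
    then have "v = (\<chi> k. det (A k y) / Jac y)"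
      using cramer[of "matrix (Phi' y)" v w] that(1) by (simp add: Jac_def A_def)
    then have "v $ k = det (A k y) / Jac y" for k
      by (metis vec_lambda_beta)
    then have "mpoly_grad f y \<bullet> v = (\<Sum>k\<in>UNIV. mpoly_grad f y $ k * det (A k y)) / Jac y"
      by (simp add: inner_vec_def sum_divide_distrib)
    then show ?thesis using that(1) by (simp add: q power2_eq_square)
  qed
  have "mpoly_eval q y = 0" if y: "y \<in> V" for y
  proof (cases "Jac y = 0")
    case True then show ?thesis by (simp add: q)
  next
    case False
    obtain v where v: "Phi' y v = w" using bij_Phi'[OF False] by (metis bij_pointE)
    then have "Phi' y v = w + (\<Sum>b\<in>B. 0 *\<^sub>R b)" by simp
    from Phi'_components(2)[OF this w] have "b \<bullet> v = 0" if "b \<in> (\<lambda>b. mpoly_grad (g b) y) ` B" for b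
      using that by auto
    moreover have "mpoly_grad f y \<in> span ((\<lambda>b. mpoly_grad (g b) y) ` B)"
      using span_gradients(1)[OF y False] f span_base[of "mpoly_grad f y" "gradients V y"]
      by (auto simp: gradients_def)
    ultimately have "mpoly_grad f y \<bullet> v = 0"
      using orthogonal_to_span[of "mpoly_grad f y" _ v] by (auto simp: orthogonal_def inner_commute)
    then show ?thesis using eq[OF False v] by simp
  qed
  then show ?thesis using eq by (auto simp: vanishing_ideal_def)
qed

text \<open>Hence on a curve with such velocities, the defining equations of \<open>V\<close> satisfy a homogeneous
  linear differential inequality.\<close>

lemma curve_in_variety:
  assumes R: "finite R" "R \<subseteq> vanishing_ideal V"
      "\<And>f. f \<in> vanishing_ideal V \<Longrightarrow> \<exists>c. continuous_on UNIV c \<and>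
       (\<forall>y. \<bar>mpoly_eval f y\<bar> \<le> c y * (\<Sum>\<rho>\<in>R. \<bar>mpoly_eval \<rho> y\<bar>))"
      "\<And>y. (\<And>\<rho>. \<rho> \<in> R \<Longrightarrow> mpoly_eval \<rho> y = 0) \<Longrightarrow> y \<in> V"
    and w: "\<And>b. b \<in> B \<Longrightarrow> b \<bullet> w = 0"
    and \<gamma>: "\<gamma> 0 \<in> V" "\<And>t. t \<in> {0..1} \<Longrightarrow> (\<gamma> has_vector_derivative v t) (at t)"
      "\<And>t. t \<in> {0..1} \<Longrightarrow> Jac (\<gamma> t) \<noteq> 0" "\<And>t. t \<in> {0..1} \<Longrightarrow> Phi' (\<gamma> t) (v t) = w"
  shows "\<gamma> 1 \<in> V"
proof -
  have "\<exists>q c. q \<in> vanishing_ideal V \<and>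
      (\<forall>y v. Jac y \<noteq> 0 \<longrightarrow> Phi' y v = w \<longrightarrow> mpoly_eval q y = (Jac y)\<^sup>2 * (mpoly_grad \<rho> y \<bullet> v)) \<and>
      continuous_on UNIV c \<and> (\<forall>y. \<bar>mpoly_eval q y\<bar> \<le> c y * (\<Sum>\<rho>\<in>R. \<bar>mpoly_eval \<rho> y\<bar>))"
    if \<rho>: "\<rho> \<in> R" for \<rho>
  proof -
    have "\<rho> \<in> vanishing_ideal V" using R(2) \<rho> by blast
    from tangential_derivative_vanishing[OF this, of w] w obtain q where "q \<in> vanishing_ideal V"
      "\<forall>y v. Jac y \<noteq> 0 \<longrightarrow> Phi' y v = w \<longrightarrow> mpoly_eval q y = (Jac y)\<^sup>2 * (mpoly_grad \<rho> y \<bullet> v)"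
      by blast
    then show ?thesis using R(3)[of q] by blast
  qed
  then obtain q c where q: "\<And>\<rho> y v. \<rho> \<in> R \<Longrightarrow> Jac y \<noteq> 0 \<Longrightarrow> Phi' y v = w \<Longrightarrow>
        mpoly_eval (q \<rho>) y = (Jac y)\<^sup>2 * (mpoly_grad \<rho> y \<bullet> v)"
    and c: "\<And>\<rho>. \<rho> \<in> R \<Longrightarrow> continuous_on UNIV (c \<rho>)"
      "\<And>\<rho> y. \<rho> \<in> R \<Longrightarrow> \<bar>mpoly_eval (q \<rho>) y\<bar> \<le> c \<rho> y * (\<Sum>\<rho>\<in>R. \<bar>mpoly_eval \<rho> y\<bar>)"
    by metis
  define S where "S y = (\<Sum>\<rho>\<in>R. \<bar>mpoly_eval \<rho> y\<bar>)" for y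
  \<comment> \<open>The bounds \<open>c\<close> refer to the sum \<open>S\<close> of absolute
    values, but the sum of squares \<open>E\<close> is differentiable; Cauchy-Schwarz connects the
    two.\<close>
  define E where "E t = (\<Sum>\<rho>\<in>R. (mpoly_eval \<rho> (\<gamma> t))\<^sup>2)" for t
  define \<kappa> where "\<kappa> t = (\<Sum>\<rho>\<in>R. 2 * \<bar>c \<rho> (\<gamma> t)\<bar> / (Jac (\<gamma> t))\<^sup>2)" for t
  have cont_\<gamma>: "continuous_on {0..1} \<gamma>"
    using \<gamma>(2) by (meson continuous_at_imp_continuous_on has_vector_derivative_continuous)
  obtain J where "Jac = mpoly_eval J" using polynomial_Jac by (auto simp: polynomial_fun_def)
  then have "continuous_on UNIV Jac" by (simp add: continuous_on_mpoly_eval)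
  then have cont: "continuous_on {0..1} \<kappa>"
    unfolding \<kappa>_def using \<gamma>(3)
    by (intro continuous_intros continuous_on_compose2[OF c(1) cont_\<gamma>]
        continuous_on_compose2[OF \<open>continuous_on UNIV Jac\<close> cont_\<gamma>]) auto
  then obtain K where K: "\<And>t. t \<in> {0..1} \<Longrightarrow> \<kappa> t \<le> K"
    using compact_continuous_image[OF cont] compact_imp_bounded bounded_imp_bdd_above
    unfolding bdd_above_def by (metis compact_Icc imageI)
  have \<kappa>0: "0 \<le> \<kappa> t" for t unfolding \<kappa>_def by (intro sum_nonneg) auto
  have E0: "0 \<le> E t" for t unfolding E_def by (intro sum_nonneg) auto
  have SE: "(S (\<gamma> t))\<^sup>2 \<le> card R * E t" for t
    using Cauchy_Schwarz_ineq_sum[of "\<lambda>_. 1" "\<lambda>\<rho>. \<bar>mpoly_eval \<rho> (\<gamma> t)\<bar>" R] by (simp add: S_def E_def)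
  have "E 1 = 0"
  proof (rule gronwall_zero)
    fix t :: real assume t: "t \<in> {0..1}"
    have "((\<lambda>t. mpoly_eval \<rho> (\<gamma> t)) has_real_derivative mpoly_grad \<rho> (\<gamma> t) \<bullet> v t) (at t)" for \<rho>
    proof -
      have "((\<lambda>t. mpoly_eval \<rho> (\<gamma> t)) has_derivative (\<lambda>s. mpoly_grad \<rho> (\<gamma> t) \<bullet> (s *\<^sub>R v t))) (at t)"
        using has_derivative_compose[OF \<gamma>(2)[OF t, unfolded has_vector_derivative_def]
            has_derivative_mpoly_eval_real] .
      then show ?thesis
        by (rule has_derivative_imp_has_field_derivative) (simp add: mult_ac)
    qed
    then show "(E has_real_derivative (\<Sum>\<rho>\<in>R. 2 * mpoly_eval \<rho> (\<gamma> t) * (mpoly_grad \<rho> (\<gamma> t) \<bullet> v t))) (at t)"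
      unfolding E_def by (auto intro!: derivative_eq_intros sum.cong)
    have "(\<Sum>\<rho>\<in>R. 2 * mpoly_eval \<rho> (\<gamma> t) * (mpoly_grad \<rho> (\<gamma> t) \<bullet> v t)) \<le>
        (\<Sum>\<rho>\<in>R. 2 * \<bar>c \<rho> (\<gamma> t)\<bar> / (Jac (\<gamma> t))\<^sup>2 * (S (\<gamma> t))\<^sup>2)"
    proof (rule sum_mono)
      fix \<rho> assume \<rho>: "\<rho> \<in> R"
      let ?d = "mpoly_grad \<rho> (\<gamma> t) \<bullet> v t"
      have J: "(Jac (\<gamma> t))\<^sup>2 > 0" using \<gamma>(3)[OF t] by simp
      have "(Jac (\<gamma> t))\<^sup>2 * \<bar>?d\<bar> = \<bar>mpoly_eval (q \<rho>) (\<gamma> t)\<bar>"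
        by (simp add: q[OF \<rho> \<gamma>(3)[OF t] \<gamma>(4)[OF t]] abs_mult)
      also have "\<dots> \<le> c \<rho> (\<gamma> t) * S (\<gamma> t)" using c(2)[OF \<rho>] by (simp add: S_def)
      also have "\<dots> \<le> \<bar>c \<rho> (\<gamma> t)\<bar> * S (\<gamma> t)"
        by (intro mult_right_mono) (auto simp: S_def sum_nonneg)
      finally have d: "\<bar>?d\<bar> \<le> \<bar>c \<rho> (\<gamma> t)\<bar> * S (\<gamma> t) / (Jac (\<gamma> t))\<^sup>2"
        using J by (simp add: field_simps)
      have m: "\<bar>mpoly_eval \<rho> (\<gamma> t)\<bar> \<le> S (\<gamma> t)"
        unfolding S_def by (rule member_le_sum[where f = "\<lambda>\<rho>. \<bar>mpoly_eval \<rho> (\<gamma> t)\<bar>"]) (use \<rho> R in auto)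
      have "2 * mpoly_eval \<rho> (\<gamma> t) * ?d \<le> 2 * (\<bar>mpoly_eval \<rho> (\<gamma> t)\<bar> * \<bar>?d\<bar>)"
        by (simp flip: abs_mult)
      also have "\<dots> \<le> 2 * (S (\<gamma> t) * (\<bar>c \<rho> (\<gamma> t)\<bar> * S (\<gamma> t) / (Jac (\<gamma> t))\<^sup>2))"
        by (intro mult_left_mono mult_mono d m) (auto simp: S_def sum_nonneg)
      finally show "2 * mpoly_eval \<rho> (\<gamma> t) * ?d \<le> 2 * \<bar>c \<rho> (\<gamma> t)\<bar> / (Jac (\<gamma> t))\<^sup>2 * (S (\<gamma> t))\<^sup>2"
        by (simp add: power2_eq_square mult_ac)
    qed
    also have "\<dots> = \<kappa> t * (S (\<gamma> t))\<^sup>2" by (simp add: \<kappa>_def sum_distrib_right)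
    also have "\<dots> \<le> K * (card R * E t)"
      using K[OF t] \<kappa>0[of t] by (intro mult_mono SE) auto
    finally show "(\<Sum>\<rho>\<in>R. 2 * mpoly_eval \<rho> (\<gamma> t) * (mpoly_grad \<rho> (\<gamma> t) \<bullet> v t)) \<le> (K * card R) * E t"
      by simp
  next
    show "E 0 = 0" using \<gamma>(1) R(2) by (auto simp: E_def vanishing_ideal_def subset_iff intro!: sum.neutral)
  qed (rule E0)
  then have "mpoly_eval \<rho> (\<gamma> 1) = 0" if "\<rho> \<in> R" for \<rho>
    using that R(1) by (simp add: E_def sum_nonneg_eq_0_iff)
  then show ?thesis by (rule R(4))
qed

lemma Jac_nonzero_imp_smooth:
  assumes "x0 \<in> smooth_points V" "y \<in> V" "Jac y \<noteq> 0"
  shows "y \<in> smooth_points V"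
  using smooth_point_dim_gradients(2)[OF assms(1,2)] span_gradients(2)[OF assms(2,3)] dim_le[OF x0]
  by simp

lemma Phi_on_V: "y \<in> V \<Longrightarrow> Phi y = P (y - x0)"
  using gI by (auto simp: Phi_def vanishing_ideal_def intro!: sum.neutral)

section \<open>The inverse function theorem and the chart\<close>

lemma local_inverse:
  obtains U W \<psi> where "open U" "x0 \<in> U" "\<And>y. y \<in> U \<Longrightarrow> Jac y \<noteq> 0" "open W" "0 \<in> W"
    "homeomorphism U W Phi \<psi>" "\<And>z. z \<in> W \<Longrightarrow> (\<psi> has_derivative inv (Phi' (\<psi> z))) (at z)"
proof -
  define \<Phi>' where "\<Phi>' y = Blinfun (Phi' y)" for y
  have app: "blinfun_apply (\<Phi>' y) = Phi' y" for y
    unfolding \<Phi>'_def by (rule bounded_linear_Blinfun_apply)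
      (use linear_Phi' linear_conv_bounded_linear in blast)
  obtain J where J: "Jac = mpoly_eval J" using polynomial_Jac by (auto simp: polynomial_fun_def)
  define U where "U = {y. Jac y \<noteq> 0}"
  have contJ: "continuous_on UNIV Jac" by (simp add: J continuous_on_mpoly_eval)
  have U: "open U" unfolding U_def by (rule open_Collect_neq[OF contJ]) auto
  have "continuous_on U (\<lambda>y. Phi' y v)" for v
  proof -
    have "continuous_on U (\<lambda>y. Phi' y v $ i)" for i
      using polynomial_Phi'_entry[of v i] continuous_on_mpoly_eval by (metis polynomial_fun_def)
    then have "continuous_on U (\<lambda>y. \<chi> i. Phi' y v $ i)"
      by (rule continuous_on_vec_lambda)
    then show ?thesis by simp
  qed
  then have cont: "continuous_on U \<Phi>'"
    by (intro continuous_on_blinfun_componentwise) (simp add: app)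
  have x0U: "x0 \<in> U" using Jac_x0 by (simp add: U_def)
  have "inj (Phi' x0)" using Jac_x0 Jac_nonzero_iff by blast
  then obtain h where h: "linear h" "h \<circ> Phi' x0 = id"
    using linear_injective_left_inverse[OF linear_Phi'] by blast
  then have "Blinfun h o\<^sub>L \<Phi>' x0 = id_blinfun"
    by (intro blinfun_eqI)
      (simp add: app bounded_linear_Blinfun_apply linear_conv_bounded_linear pointfree_idE)
  moreover have "(Phi has_derivative blinfun_apply (\<Phi>' y)) (at y)" for y
    by (simp add: app has_derivative_Phi)
  ultimately obtain U' W \<psi> \<psi>' where *: "open U'" "U' \<subseteq> U" "x0 \<in> U'" "open W" "Phi x0 \<in> W"
    "homeomorphism U' W Phi \<psi>" "\<And>y. y \<in> W \<Longrightarrow> (\<psi> has_derivative (\<psi>' y)) (at y)"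
    "\<And>y. y \<in> W \<Longrightarrow> \<psi>' y = inv (blinfun_apply (\<Phi>' (\<psi> y)))"
    using inverse_function_theorem[OF U _ cont x0U, of Phi] by metis
  show ?thesis
  proof (rule that[of U' W \<psi>])
    show "Jac y \<noteq> 0" if "y \<in> U'" for y using that * by (auto simp: U_def)
    show "0 \<in> W" using *(5) Phi_on_V[OF x0] linear_0[OF linP] by simp
    show "(\<psi> has_derivative inv (Phi' (\<psi> z))) (at z)" if "z \<in> W" for z
      using *(7,8)[OF that] by (simp add: app)
  qed (use * in auto)
qed

text \<open>\<open>\<phi>\<close> is the local inverse of \<open>Phi\<close> composed with
  \<open>P\<close>. It is defined on a full ball of the ambient space and constant along
  \<open>span B\<close>; instead of a parameter space of dimension \<open>CARD('p) - card B\<close>,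
  the rank of the derivative records this number.\<close>

lemma chart:
  assumes V: "real_variety V" and sm: "x0 \<in> smooth_points V"
  obtains \<epsilon> and \<phi> :: "real ^ 'p \<Rightarrow> real ^ 'p" and \<phi>' where "0 < \<epsilon>"
    "\<And>w. w \<in> ball 0 \<epsilon> \<Longrightarrow> (\<phi> has_derivative \<phi>' w) (at w)"
    "\<And>w. w \<in> ball 0 \<epsilon> \<Longrightarrow> CARD('p) - card B \<le> dim (range (\<phi>' w))"
    "\<And>w \<delta>. ball w \<delta> \<subseteq> ball 0 \<epsilon> \<Longrightarrow> openin (top_of_set (smooth_points V)) (\<phi> ` ball w \<delta>)"
proof -
  obtain R where R: "finite R" "R \<subseteq> vanishing_ideal V"
      "\<And>f. f \<in> vanishing_ideal V \<Longrightarrow> \<exists>c. continuous_on UNIV c \<and>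
       (\<forall>y. \<bar>mpoly_eval f y\<bar> \<le> c y * (\<Sum>\<rho>\<in>R. \<bar>mpoly_eval \<rho> y\<bar>))"
      "\<And>y. (\<And>\<rho>. \<rho> \<in> R \<Longrightarrow> mpoly_eval \<rho> y = 0) \<Longrightarrow> y \<in> V"
    using finite_equations[OF V sm] by blast
  obtain U W \<psi> where U: "open U" "x0 \<in> U" "\<And>y. y \<in> U \<Longrightarrow> Jac y \<noteq> 0" and W: "open W" "0 \<in> W"
    and hom: "homeomorphism U W Phi \<psi>"
    and der: "\<And>z. z \<in> W \<Longrightarrow> (\<psi> has_derivative inv (Phi' (\<psi> z))) (at z)"
    using local_inverse by blast
  obtain \<epsilon> where \<epsilon>: "0 < \<epsilon>" "ball 0 \<epsilon> \<subseteq> W" using W open_contains_ball by blast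
  have \<psi>: "\<psi> z \<in> U" "Phi (\<psi> z) = z" if "z \<in> ball 0 \<epsilon>" for z
    using hom \<epsilon>(2) that by (auto simp: homeomorphism_def)
  have \<psi>Phi: "\<psi> (Phi y) = y" if "y \<in> U" for y
    using hom that by (auto simp: homeomorphism_def)
  have Pball: "P w \<in> ball 0 \<epsilon>" if "w \<in> ball 0 \<epsilon>" for w
    using that norm_P_le[of w] by simp
  define \<phi> where "\<phi> w = \<psi> (P w)" for w
  define \<phi>' where "\<phi>' w = (\<lambda>v. inv (Phi' (\<phi> w)) (P v))" for w
  have blP: "bounded_linear P" using linP linear_conv_bounded_linear by blast
  have der\<phi>: "(\<phi> has_derivative \<phi>' w) (at w)" if "w \<in> ball 0 \<epsilon>" for w
    using has_derivative_compose[OF bounded_linear_imp_has_derivative[OF blP] der[of "P w"]]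
      Pball[OF that] \<epsilon>(2) unfolding \<phi>_def[abs_def] \<phi>'_def by blast
  have J\<phi>: "Jac (\<phi> w) \<noteq> 0" "\<phi> w \<in> U" "Phi (\<phi> w) = P w" if "w \<in> ball 0 \<epsilon>" for w
    using \<psi>[OF Pball[OF that]] U(3) by (auto simp: \<phi>_def)
  have Phi'\<phi>': "Phi' (\<phi> w) (\<phi>' w v) = P v" if "w \<in> ball 0 \<epsilon>" for w v
    unfolding \<phi>'_def using bij_Phi'[OF J\<phi>(1)[OF that]] by (simp add: bij_is_surj surj_f_inv_f)
  have dim: "CARD('p) - card B \<le> dim (range (\<phi>' w))" if "w \<in> ball 0 \<epsilon>" for w
  proof -
    have "range P = Phi' (\<phi> w) ` range (\<phi>' w)"
      using Phi'\<phi>'[OF that] by (simp add: image_image)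
    then have "dim (range P) \<le> dim (range (\<phi>' w))"
      using dim_image_le[OF linear_Phi'] by simp
    then show ?thesis using dim_range_P by simp
  qed
  have \<phi>0: "\<phi> 0 = x0"
    using \<psi>Phi[OF U(2)] Phi_on_V[OF x0] linear_0[OF linP] by (simp add: \<phi>_def)
  have \<phi>V: "\<phi> w \<in> V" if w: "w \<in> ball 0 \<epsilon>" for w
  proof -
    have tw: "t *\<^sub>R w \<in> ball 0 \<epsilon>" if "t \<in> {0..1}" for t
    proof -
      have "norm (t *\<^sub>R w) \<le> norm w" using that by (simp add: mult_left_le_one_le)
      then show ?thesis using w by simp
    qed
    \<comment> \<open>On the image of the segment from 0 to \<open>w\<close> the straightened
      velocity is constantly \<open>P w\<close>, which is orthogonal to \<open>B\<close>, and the
      curve starts at \<open>x0\<close>.\<close>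
    have "(\<lambda>t. \<phi> (t *\<^sub>R w)) 1 \<in> V"
    proof (rule curve_in_variety[OF R, where w = "P w" and v = "\<lambda>t. \<phi>' (t *\<^sub>R w) w"])
      show "((\<lambda>t. \<phi> (t *\<^sub>R w)) has_vector_derivative \<phi>' (t *\<^sub>R w) w) (at t)" if "t \<in> {0..1}" for t
      proof -
        have "((\<lambda>t. t *\<^sub>R w) has_derivative (\<lambda>s. s *\<^sub>R w)) (at t)"
          by (auto intro!: derivative_eq_intros)
        then have "((\<lambda>t. \<phi> (t *\<^sub>R w)) has_derivative (\<lambda>s. \<phi>' (t *\<^sub>R w) (s *\<^sub>R w))) (at t)"
          using der\<phi>[OF tw[OF that]] by (rule has_derivative_compose)
        moreover have "linear (\<phi>' (t *\<^sub>R w))"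
          using der\<phi>[OF tw[OF that]] has_derivative_linear by blast
        ultimately show ?thesis
          unfolding has_vector_derivative_def by (simp add: linear_cmul)
      qed
    qed (use \<phi>0 x0 J\<phi>(1) tw Phi'\<phi>' P_orth in auto)
    then show ?thesis by simp
  qed
  have "openin (top_of_set (smooth_points V)) (\<phi> ` ball w \<delta>)" if sub: "ball w \<delta> \<subseteq> ball 0 \<epsilon>" for w \<delta>
  proof -
    define Q where "Q = U \<inter> Phi -` (ball (P w) \<delta>)"
    have "continuous_on U Phi" using hom by (simp add: homeomorphism_def)
    then have Q: "open Q" unfolding Q_def by (rule continuous_open_preimage[OF _ U(1) open_ball])
    have "\<phi> ` ball w \<delta> = smooth_points V \<inter> Q"
    proof (intro set_eqI iffI)
      fix y assume "y \<in> \<phi> ` ball w \<delta>"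
      then obtain w' where w': "w' \<in> ball w \<delta>" "y = \<phi> w'" by blast
      then have b: "w' \<in> ball 0 \<epsilon>" using sub by blast
      have "dist (P w) (P w') < \<delta>"
        using w'(1) norm_P_le[of "w - w'"] by (simp add: dist_norm P_diff)
      then show "y \<in> smooth_points V \<inter> Q"
        using J\<phi>[OF b] \<phi>V[OF b] Jac_nonzero_imp_smooth[OF sm] by (auto simp: w' Q_def)
    next
      fix y assume y: "y \<in> smooth_points V \<inter> Q"
      then have yV: "y \<in> V" and yU: "y \<in> U" and d: "dist (P w) (Phi y) < \<delta>"
        by (auto simp: smooth_points_def Q_def)
      have PPhi: "P (Phi y) = Phi y" using Phi_on_V[OF yV] P_P by simp
      \<comment> \<open>The component of \<open>w\<close> in \<open>span B\<close> is kept, so the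
        distance from \<open>w\<close> is just that between \<open>P w\<close> and
        \<open>Phi y\<close>.\<close>
      define w' where "w' = w - P w + Phi y"
      have "w' \<in> ball w \<delta>" using d by (simp add: w'_def dist_norm)
      moreover have "P w' = Phi y" by (simp add: w'_def P_add P_diff P_P PPhi)
      then have "\<phi> w' = y" using \<psi>Phi[OF yU] by (simp add: \<phi>_def)
      ultimately show "y \<in> \<phi> ` ball w \<delta>" by blast
    qed
    then show ?thesis using Q by (simp add: openin_open_Int)
  qed
  then show ?thesis using that[OF \<epsilon>(1) der\<phi> dim] by blast
qed

lemma variety_dim_le:
  assumes irr: "irreducible_set V"
  shows "variety_dim V \<le> enat (CARD('p) - card B)"
  unfolding variety_dim_def alg_dim_def
proof (rule Sup_least)
  fix e assume "e \<in> {enat n | n. \<exists>Z :: nat \<Rightarrow> (complex ^ 'p) set.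
     (\<forall>i\<le>n. irreducible_set (Z i) \<and> Z i \<subseteq> complexification V) \<and> (\<forall>i<n. Z i \<subset> Z (Suc i))}"
  then obtain n and Z :: "nat \<Rightarrow> (complex ^ 'p) set" where e: "e = enat n"
    and Z: "\<And>i. i \<le> n \<Longrightarrow> irreducible_set (Z i)" "\<And>i. i \<le> n \<Longrightarrow> Z i \<subseteq> complexification V"
      "\<And>i. i < n \<Longrightarrow> Z i \<subset> Z (Suc i)"
    by blast
  obtain t :: "nat \<Rightarrow> (complex, 'p) mpoly" where "alg_independent (Z n) {..<n} t"
    using chain_alg_independent[of n Z] Z(1,3) by blast
  then have ind: "alg_independent (complex_vec ` V) {..<n} t"
    using alg_independent_mono Z(2) alg_independent_real_points by blast
  obtain J where J: "Jac = mpoly_eval J" using polynomial_Jac by (auto simp: polynomial_fun_def)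
  have "card {..<n} + card B \<le> CARD('p)"
  proof (rule alg_independent_card_bound[OF irr ind _ finB])
    show "mpoly_eval (g b) x = 0" if "b \<in> B" "x \<in> V" for b x
      using gI that by (auto simp: vanishing_ideal_def)
    show "x0 \<in> V" "mpoly_eval J x0 \<noteq> 0" using x0 Jac_x0 J by auto
    show "\<exists>v. \<forall>b\<in>B. mpoly_grad (g b) x \<bullet> v = z b" if "mpoly_eval J x \<noteq> 0" for x z
      using gradients_surj that J by auto
  qed simp
  then show "e \<le> enat (CARD('p) - card B)" by (simp add: e)
qed

end

lemma smooth_frame_exists:
  fixes V :: "(real ^ 'p::finite) set"
  assumes "x0 \<in> smooth_points V"
  obtains B g P where "smooth_frame V x0 B g P"
proof -
  obtain B where B: "B \<subseteq> gradients V x0" "independent B" "card B = dim (gradients V x0)"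
    using basis_exists[of "gradients V x0"] by metis
  have "\<forall>b\<in>B. \<exists>f. f \<in> vanishing_ideal V \<and> mpoly_grad f x0 = b"
    using B(1) by (auto simp: gradients_def)
  then obtain g where g: "\<And>b. b \<in> B \<Longrightarrow> g b \<in> vanishing_ideal V"
    "\<And>b. b \<in> B \<Longrightarrow> mpoly_grad (g b) x0 = b" by metis
  obtain C where C: "pairwise orthogonal C" "\<And>c. c \<in> C \<Longrightarrow> norm c = 1" "span C = span B" "independent C"
    using orthonormal_basis_subspace[OF subspace_span[of B]] by metis
  have finC: "finite C" using C(4) independent_imp_finite by blast
  \<comment> \<open>An orthonormal basis \<open>C\<close> of \<open>span B\<close> is used because
    the gradients in \<open>B\<close> need not be orthogonal.\<close>
  define P where "P v = v - (\<Sum>c\<in>C. (v \<bullet> c) *\<^sub>R c)" for v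
  have orthC: "c \<bullet> P v = 0" if c: "c \<in> C" for c v
  proof -
    have "c \<bullet> (\<Sum>c'\<in>C. (v \<bullet> c') *\<^sub>R c') = (\<Sum>c'\<in>C. if c' = c then v \<bullet> c else 0)"
      unfolding inner_sum_right
    proof (intro sum.cong refl)
      fix c' assume "c' \<in> C"
      then show "c \<bullet> (v \<bullet> c') *\<^sub>R c' = (if c' = c then v \<bullet> c else 0)"
        using C(1,2) c by (auto simp: pairwise_def orthogonal_def norm_eq_1)
    qed
    also have "\<dots> = v \<bullet> c" using finC c by simp
    finally show ?thesis by (simp add: P_def inner_diff_right inner_commute)
  qed
  have orthB: "b \<bullet> P v = 0" if "b \<in> B" for b v
    using orthogonal_to_span[of b C "P v"] orthC C(3) span_base[OF that]
    by (auto simp: orthogonal_def inner_commute)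
  have "linear P"
    unfolding P_def
    by (intro linear_compose_sub linear_compose_sum ballI linearI)
      (auto simp: inner_add_left algebra_simps)
  moreover have "v - P v \<in> span B" for v
    unfolding C(3)[symmetric] P_def by (simp add: span_sum span_scale span_base)
  moreover have "x0 \<in> V" using assms by (simp add: smooth_points_def)
  moreover have "dim (gradients V y) \<le> card B" if "y \<in> V" for y
    using smooth_point_dim_gradients(1)[OF assms that] B(3) by simp
  ultimately have "smooth_frame V x0 B g P"
    unfolding smooth_frame_def using B(2) g orthB by blast
  then show ?thesis by (rule that)
qed

subsection \<open>Supporting hyperplanes of generally neighborly sets\<close>

text \<open>The linear space parallel to the affine hull of \<open>M\<close>, written without a base
  point.\<close>

definition directions :: "'a::real_vector set \<Rightarrow> 'a set" where
  "directions M = span {y - z | y z. y \<in> M \<and> z \<in> M}"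

lemma directions_mono: "M \<subseteq> N \<Longrightarrow> directions M \<subseteq> directions N"
  unfolding directions_def by (intro span_mono) auto

lemma directions_subset:
  assumes "subspace S" "\<And>y. y \<in> M \<Longrightarrow> y - a \<in> S"
  shows "directions M \<subseteq> S"
  unfolding directions_def
proof (rule span_minimal[OF _ assms(1)], clarify)
  fix y z assume "y \<in> M" "z \<in> M"
  then have "(y - a) - (z - a) \<in> S" using assms by (blast intro: subspace_diff)
  then show "y - z \<in> S" by simp
qed

lemma affine_hull_diff_in_directions:
  assumes "v \<in> affine hull M" "w \<in> affine hull M"
  shows "v - w \<in> directions M"
proof -
  have "M \<noteq> {}" using assms by auto
  then obtain a where a: "a \<in> M" by blast
  let ?A = "(+) a ` directions M"
  have sub: "subspace (directions M)" by (simp add: directions_def)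
  have "affine hull M \<subseteq> ?A"
  proof (rule hull_minimal)
    show "M \<subseteq> ?A"
    proof
      fix y assume "y \<in> M"
      then have "y - a \<in> directions M" using a by (auto simp: directions_def intro: span_base)
      then show "y \<in> ?A" by (intro image_eqI[of _ _ "y - a"]) auto
    qed
    show "affine ?A" using subspace_imp_affine[OF sub] affine_translation by blast
  qed
  then obtain v' w' where "v' \<in> directions M" "w' \<in> directions M" "v = a + v'" "w = a + w'"
    using assms by blast
  then show ?thesis using subspace_diff[OF sub] by simp
qed

section \<open>Approximation by neighborly configurations\<close>

lemma finite_set_separated:
  fixes S :: "'a::metric_space set"
  assumes "finite S"
  obtains \<delta> where "0 < \<delta>" "\<And>x y. x \<in> S \<Longrightarrow> y \<in> S \<Longrightarrow> x \<noteq> y \<Longrightarrow> \<delta> \<le> dist x y"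
proof -
  let ?D = "insert 1 ((\<lambda>(x, y). dist x y) ` {p \<in> S \<times> S. fst p \<noteq> snd p})"
  have fin: "finite ?D" using assms by auto
  show ?thesis
  proof (rule that[of "Min ?D"])
    show "0 < Min ?D" using fin by (subst Min_gr_iff) auto
    show "Min ?D \<le> dist x y" if "x \<in> S" "y \<in> S" "x \<noteq> y" for x y
      using fin that by (intro Min_le) force+
  qed
qed

text \<open>Faces of a polytope are exposed, and the normal exposing a proper nonempty face can be
  taken parallel to the affine hull. For \<open>S = vertices Q\<close> such a normal would be
  orthogonal to itself; hence the strict inclusion.\<close>

lemma neighborly_polytope_face_normal:
  fixes Q :: "'a::euclidean_space set"
  assumes Q: "neighborly_polytope k Q" and S: "S \<subset> vertices Q" "card S \<le> k" "S \<noteq> {}"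
  obtains u where "norm u = 1" "u \<in> directions (vertices Q)"
    "\<And>v s. v \<in> vertices Q \<Longrightarrow> s \<in> S \<Longrightarrow> u \<bullet> (v - s) \<le> 0"
proof -
  have poly: "polytope Q" using Q by (simp add: neighborly_polytope_def)
  obtain F where F: "F face_of Q" "vertices F = S"
    using Q S by (auto simp: neighborly_polytope_def)
  have "F exposed_face_of Q"
    using F(1) exposed_face_of_polyhedron[OF polytope_imp_polyhedron[OF poly]] by simp
  moreover have "F \<noteq> Q" using F(2) S(1) by blast
  moreover have "F \<noteq> {}" using F(2) S(3) by (auto simp: vertices_def extreme_point_of_def)
  ultimately obtain a b where a: "Q \<subseteq> {x. a \<bullet> x \<le> b}" "F = Q \<inter> {x. a \<bullet> x = b}" "a \<noteq> 0"
    "\<forall>w \<in> affine hull Q. w + a \<in> affine hull Q"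
    unfolding exposed_face_of_parallel by blast
  have hull: "Q = convex hull (vertices Q)"
    unfolding vertices_def
    by (rule Krein_Milman_Minkowski) (use poly polytope_imp_compact polytope_imp_convex in auto)
  obtain w where "w \<in> vertices Q" using S(1) by blast
  then have w: "w \<in> affine hull Q"
    by (intro hull_inc) (simp add: vertices_def extreme_point_of_def)
  have "(w + a) - w \<in> directions (vertices Q)"
  proof (rule affine_hull_diff_in_directions)
    have "affine hull Q = affine hull (vertices Q)"
      by (subst hull) (rule affine_hull_convex_hull)
    then show "w + a \<in> affine hull (vertices Q)" "w \<in> affine hull (vertices Q)" using a(4) w by auto
  qed
  then have dir: "a \<in> directions (vertices Q)" by simp
  show ?thesis
  proof (rule that[of "a /\<^sub>R norm a"])
    show "norm (a /\<^sub>R norm a) = 1" using a(3) by simp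
    show "a /\<^sub>R norm a \<in> directions (vertices Q)"
      using dir unfolding directions_def by (rule span_scale)
    fix v s assume "v \<in> vertices Q" "s \<in> S"
    then have "v \<in> Q" "s \<in> F" using F(2) by (auto simp: vertices_def extreme_point_of_def)
    then have "a \<bullet> (v - s) \<le> 0" using a by (auto simp: inner_diff_right)
    then show "(a /\<^sub>R norm a) \<bullet> (v - s) \<le> 0"
      using a(3) by (simp add: mult_le_0_iff)
  qed
qed

text \<open>By density, the \<open>x i\<close>, the points of \<open>Y\<close> and some auxiliary
  points move slightly within \<open>M\<close> to the vertices of a neighborly polytope. The moved
  \<open>x i\<close> are the vertices of a face, whose normal errs by at most two
  displacements.\<close>

lemma approximate_supporting_normal:
  fixes X :: "'a::euclidean_space set"
  assumes dense: "\<And>n. \<exists>U \<subseteq> {x \<in> {..<n} \<rightarrow>\<^sub>E X. neighborly_set k (x ` {..<n})}.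
      power_space n X closure_of U = topspace (power_space n X)"
    and M: "openin (top_of_set X) M" "infinite M" and k: "k \<ge> 1"
    and x: "\<And>i. i < k \<Longrightarrow> x i \<in> M" and Y: "finite Y" "Y \<subseteq> M" and "0 < \<epsilon>"
  obtains u where "norm u = 1" "u \<in> directions M"
    "\<And>i y. i < k \<Longrightarrow> y \<in> Y \<Longrightarrow> u \<bullet> (y - x i) \<le> \<epsilon>"
proof -
  \<comment> \<open>These \<open>k + 1\<close> points keep the face proper: their displaced copies
    cannot all be among the at most \<open>k\<close> displaced copies of the
    \<open>x i\<close>.\<close>
  obtain Y0 where Y0: "finite Y0" "card Y0 = Suc k" "Y0 \<subseteq> M"
    using infinite_arbitrarily_large[OF M(2)] by blast
  obtain \<delta> where \<delta>: "0 < \<delta>" "\<And>x y. x \<in> Y0 \<Longrightarrow> y \<in> Y0 \<Longrightarrow> x \<noteq> y \<Longrightarrow> \<delta> \<le> dist x y"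
    using finite_set_separated[OF Y0(1)] by blast
  obtain N h where h: "Y \<union> Y0 = h ` {..<N :: nat}"
    using finite_imp_nat_seg_image_inj_on[of "Y \<union> Y0"] Y(1) Y0(1) by (metis finite_UnI lessThan_def)
  define n where "n = k + N"
  define c where "c i = (if i < k then x i else h (i - k))" for i
  \<comment> \<open>\<open>\<epsilon> / 2\<close> allows for the displacements of \<open>y\<close>
    and of \<open>x i\<close>; \<open>\<delta> / 2\<close> ensures that no point is within
    \<open>\<eta>\<close> of two members of \<open>Y0\<close>.\<close>
  define \<eta> where "\<eta> = min (\<epsilon> / 2) (\<delta> / 2)"
  have \<eta>: "0 < \<eta>" "2 * \<eta> \<le> \<epsilon>" "2 * \<eta> \<le> \<delta>" using \<open>0 < \<epsilon>\<close> \<delta>(1) by (auto simp: \<eta>_def)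
  have cM: "c i \<in> M" if "i < n" for i
  proof (cases "i < k")
    case False
    then have "h (i - k) \<in> Y \<union> Y0" unfolding h using that by (auto simp: n_def)
    then show ?thesis using False Y Y0 by (auto simp: c_def)
  qed (simp add: c_def x)
  have idx: "\<exists>j<n. y = c j" if y: "y \<in> Y \<union> Y0" for y
  proof -
    obtain l where "l < N" "y = h l" using y unfolding h by blast
    then show ?thesis by (intro exI[of _ "k + l"]) (simp add: n_def c_def)
  qed
  define T where "T i = M \<inter> ball (c i) \<eta>" for i
  have "openin (power_space n X) (PiE {..<n} T)"
    unfolding power_space_def openin_PiE_gen T_def
    using M(1) by (auto intro: openin_Int_open)
  moreover have "restrict c {..<n} \<in> PiE {..<n} T"
    using cM \<eta> by (auto simp: T_def)
  ultimately obtain c' where c': "c' \<in> PiE {..<n} T" "neighborly_set k (c' ` {..<n})"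
    using dense[of n] unfolding dense_intersects_open by blast
  have close: "c' i \<in> M" "dist (c i) (c' i) < \<eta>" if "i < n" for i
    using c'(1) that by (auto simp: T_def PiE_iff)
  obtain Q where Q: "neighborly_polytope k Q" "c' ` {..<n} = vertices Q"
    using c'(2) by (auto simp: neighborly_set_def)
  define S where "S = c' ` {..<k}"
  have cardS: "card S \<le> k" using card_image_le[of "{..<k}" c'] by (simp add: S_def)
  have "S \<noteq> vertices Q"
  proof
    assume eq: "S = vertices Q"
    have "\<exists>s\<in>S. dist y s < \<eta>" if "y \<in> Y0" for y
      using idx[of y] that close(2) unfolding eq Q(2)[symmetric] by fastforce
    then obtain s where s: "\<And>y. y \<in> Y0 \<Longrightarrow> s y \<in> S \<and> dist y (s y) < \<eta>" by metis
    have "inj_on s Y0"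
    proof (rule inj_onI, rule ccontr)
      fix y y' assume *: "y \<in> Y0" "y' \<in> Y0" "s y = s y'" "y \<noteq> y'"
      have "dist y y' \<le> dist y (s y) + dist y' (s y')"
        using *(3) dist_triangle2[of y y' "s y"] by simp
      also have "\<dots> < \<delta>" using s[OF *(1)] s[OF *(2)] \<eta>(3) by linarith
      finally show False using \<delta>(2)[OF *(1,2,4)] by simp
    qed
    then have "card Y0 \<le> card S"
      by (rule card_inj_on_le) (use s in \<open>auto simp: S_def\<close>)
    then show False using Y0(2) cardS by simp
  qed
  moreover have "S \<subseteq> vertices Q" unfolding Q(2)[symmetric] S_def by (auto simp: n_def)
  moreover have "S \<noteq> {}" using k by (simp add: S_def lessThan_empty_iff)
  ultimately obtain u where u: "norm u = 1" "u \<in> directions (vertices Q)"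
    "\<And>v s. v \<in> vertices Q \<Longrightarrow> s \<in> S \<Longrightarrow> u \<bullet> (v - s) \<le> 0"
    using neighborly_polytope_face_normal[OF Q(1), of S] cardS by blast
  show ?thesis
  proof (rule that[OF u(1)])
    have "vertices Q \<subseteq> M" unfolding Q(2)[symmetric] using close(1) by auto
    then show "u \<in> directions M" using u(2) directions_mono by blast
    fix i y assume i: "i < k" and "y \<in> Y"
    then obtain j where j: "j < n" "y = c j" using idx by blast
    have "i < n" using i by (simp add: n_def)
    have "u \<bullet> (y - x i) = u \<bullet> (c' j - c' i) + u \<bullet> (c j - c' j) + u \<bullet> (c' i - c i)"
      using i by (simp add: j c_def inner_diff_right)
    also have "\<dots> \<le> 0 + norm (c j - c' j) + norm (c' i - c i)"
    proof (intro add_mono)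
      show "u \<bullet> (c' j - c' i) \<le> 0"
        by (rule u(3)) (use i j in \<open>auto simp: S_def simp flip: Q(2)\<close>)
      show "u \<bullet> (c j - c' j) \<le> norm (c j - c' j)" "u \<bullet> (c' i - c i) \<le> norm (c' i - c i)"
        using norm_cauchy_schwarz[of u "c j - c' j"] norm_cauchy_schwarz[of u "c' i - c i"] u(1) by auto
    qed
    also have "\<dots> \<le> \<epsilon>"
      using close(2)[OF j(1)] close(2)[OF \<open>i < n\<close>] \<eta>(2) by (simp add: dist_norm norm_minus_commute)
    finally show "u \<bullet> (y - x i) \<le> \<epsilon>" .
  qed
qed

text \<open>An approximate normal meets any finite set of constraints, taken with the least of their
  tolerances. The unit sphere of \<open>directions M\<close> is compact, so the constraints for all
  points of \<open>M\<close> and all positive tolerances have a common solution.\<close>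

lemma supporting_normal:
  fixes X :: "'a::euclidean_space set"
  assumes dense: "\<And>n. \<exists>U \<subseteq> {x \<in> {..<n} \<rightarrow>\<^sub>E X. neighborly_set k (x ` {..<n})}.
      power_space n X closure_of U = topspace (power_space n X)"
    and M: "openin (top_of_set X) M" "infinite M" and k: "k \<ge> 1"
    and x: "\<And>i. i < k \<Longrightarrow> x i \<in> M"
  obtains u where "norm u = 1" "u \<in> directions M" "\<And>i y. i < k \<Longrightarrow> y \<in> M \<Longrightarrow> u \<bullet> (y - x i) \<le> 0"
proof -
  let ?S = "sphere 0 1 \<inter> directions M"
  define C where "C p = (case p of (y, \<epsilon>) \<Rightarrow> {u. \<forall>i<k. u \<bullet> (y - x i) \<le> \<epsilon>})" for p
  have "?S \<inter> (\<Inter>p\<in>M \<times> {0<..}. C p) \<noteq> {}"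
  proof (rule compact_imp_fip_image)
    have "closed (directions M)" unfolding directions_def by (rule closed_subspace) simp
    then show "compact ?S" by (intro compact_Int_closed) auto
    fix p
    have "C p = (\<Inter>i\<in>{..<k}. {u. u \<bullet> (fst p - x i) \<le> snd p})"
      by (auto simp: C_def split: prod.splits)
    then show "closed (C p)"
      by (auto intro!: closed_INT closed_Collect_le continuous_intros)
  next
    fix I assume I: "finite I" "I \<subseteq> M \<times> {0 :: real<..}"
    define \<epsilon> where "\<epsilon> = Min (insert 1 (snd ` I))"
    have \<epsilon>: "0 < \<epsilon>" unfolding \<epsilon>_def using I by (subst Min_gr_iff) auto
    have \<epsilon>_le: "\<epsilon> \<le> e" if "(y, e) \<in> I" for y e
      unfolding \<epsilon>_def using I(1) that by (intro Min_le) force+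
    have fI: "finite (fst ` I)" "fst ` I \<subseteq> M" using I by auto
    obtain u where u: "norm u = 1" "u \<in> directions M"
      "\<And>i y. i < k \<Longrightarrow> y \<in> fst ` I \<Longrightarrow> u \<bullet> (y - x i) \<le> \<epsilon>"
      by (rule approximate_supporting_normal[OF dense M k x fI \<epsilon>]) (assumption, rule that)
    have "u \<in> C p" if "p \<in> I" for p
    proof -
      obtain y e where p: "p = (y, e)" by fastforce
      have "u \<bullet> (y - x i) \<le> e" if "i < k" for i
        using u(3)[OF that, of y] \<epsilon>_le[of y e] \<open>p \<in> I\<close> p by force
      then show ?thesis by (simp add: C_def p)
    qed
    then show "?S \<inter> (\<Inter>p\<in>I. C p) \<noteq> {}" using u(1,2) by auto
  qed
  then obtain u where "u \<in> ?S" and uC: "\<And>p. p \<in> M \<times> {0<..} \<Longrightarrow> u \<in> C p"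
    by blast
  then have u: "norm u = 1" "u \<in> directions M" by auto
  have le: "u \<bullet> (y - x i) \<le> \<epsilon>" if "y \<in> M" "0 < \<epsilon>" "i < k" for y \<epsilon> i
    using uC[of "(y, \<epsilon>)"] that by (simp add: C_def)
  show ?thesis
    by (rule that[OF u]) (use le in \<open>auto intro: field_le_epsilon\<close>)
qed

subsection \<open>Tangent spaces at several points\<close>

lemma separating_normal:
  fixes x :: "'a::euclidean_space"
  assumes "x \<notin> span S"
  obtains n where "n \<bullet> x \<noteq> 0" "\<And>s. s \<in> span S \<Longrightarrow> n \<bullet> s = 0"
proof -
  obtain y z where yz: "y \<in> span S" "\<And>w. w \<in> span S \<Longrightarrow> orthogonal z w" "x = y + z"
    using orthogonal_subspace_decomp_exists by metis
  have "z \<noteq> 0" using yz assms by auto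
  then have "z \<bullet> x \<noteq> 0" using yz by (simp add: inner_add_right orthogonal_def)
  then show ?thesis using that yz(2) by (auto simp: orthogonal_def)
qed

text \<open>For \<open>n\<close> orthogonal to \<open>L = span (insert z1 S)\<close> and a suitable \<open>e\<close> orthogonal to \<open>S\<close>, the
  quotient \<open>n \<bullet> z / e \<bullet> z\<close> has zero derivative near \<open>w1\<close>, so \<open>z\<close> stays in \<open>L\<close>.\<close>

lemma curve_stays_in_span:
  fixes z :: "'b::real_normed_vector \<Rightarrow> 'a::euclidean_space"
  assumes der: "\<And>w. w \<in> A \<Longrightarrow> (z has_derivative z' w) (at w)" and "open A" "w1 \<in> A"
    and S: "subspace S" "z w1 \<notin> S"
    and tan: "\<And>w v. w \<in> A \<Longrightarrow> z w \<notin> S \<Longrightarrow> \<exists>s\<in>S. \<exists>l. z' w v = s + l *\<^sub>R z w"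
  obtains \<delta> where "0 < \<delta>" "ball w1 \<delta> \<subseteq> A" "\<And>w. w \<in> ball w1 \<delta> \<Longrightarrow> z w \<in> span (insert (z w1) S)"
proof -
  have spanS: "span S = S" using S(1) by (simp add: span_eq_iff)
  \<comment> \<open>As long as \<open>e \<bullet> z w\<close> stays nonzero, \<open>z w\<close> is
    outside \<open>S\<close> and the hypothesis on \<open>z' w\<close> applies.\<close>
  obtain e where e: "e \<bullet> z w1 \<noteq> 0" "\<And>s. s \<in> S \<Longrightarrow> e \<bullet> s = 0"
    using separating_normal[of "z w1" S] S(2) unfolding spanS by blast
  have "continuous_on A z"
    using der by (meson continuous_at_imp_continuous_on has_derivative_continuous)
  then have "continuous_on A (\<lambda>w. e \<bullet> z w)" by (intro continuous_intros)
  then have "open (A \<inter> (\<lambda>w. e \<bullet> z w) -` (- {0}))"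
    by (rule continuous_open_preimage[OF _ \<open>open A\<close>]) auto
  moreover have "w1 \<in> A \<inter> (\<lambda>w. e \<bullet> z w) -` (- {0})" using e(1) \<open>w1 \<in> A\<close> by simp
  ultimately obtain \<delta> where "0 < \<delta>" and sub: "ball w1 \<delta> \<subseteq> A \<inter> (\<lambda>w. e \<bullet> z w) -` (- {0})"
    using open_contains_ball by metis
  have ball: "w \<in> A" "e \<bullet> z w \<noteq> 0" "z w \<notin> S" if "w \<in> ball w1 \<delta>" for w
    using subsetD[OF sub that] e(2) by auto
  have "z w \<in> span (insert (z w1) S)" if w: "w \<in> ball w1 \<delta>" for w
  proof (rule ccontr)
    assume "z w \<notin> span (insert (z w1) S)"
    then obtain n where n: "n \<bullet> z w \<noteq> 0" "\<And>s. s \<in> span (insert (z w1) S) \<Longrightarrow> n \<bullet> s = 0"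
      using separating_normal by metis
    have "\<exists>c. \<forall>w\<in>ball w1 \<delta>. (n \<bullet> z w) / (e \<bullet> z w) = c"
    proof (rule has_derivative_zero_constant)
      fix w assume "w \<in> ball w1 \<delta>"
      note b = ball[OF this]
      have "((\<lambda>w. (n \<bullet> z w) / (e \<bullet> z w)) has_derivative
          (\<lambda>v. - (n \<bullet> z w) * (inverse (e \<bullet> z w) * (e \<bullet> z' w v) * inverse (e \<bullet> z w)) +
            (n \<bullet> z' w v) / (e \<bullet> z w))) (at w)"
        by (intro has_derivative_divide has_derivative_inner_right der b)
      also have "(\<lambda>v. - (n \<bullet> z w) * (inverse (e \<bullet> z w) * (e \<bullet> z' w v) * inverse (e \<bullet> z w)) +
            (n \<bullet> z' w v) / (e \<bullet> z w)) = (\<lambda>v. 0)"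
      proof
        fix v
        \<comment> \<open>Since \<open>n\<close> and \<open>e\<close> annihilate \<open>s\<close>,
          the derivatives of numerator and denominator are both \<open>l\<close> times the function
          itself, and the quotient rule cancels them.\<close>
        obtain s l where s: "s \<in> S" "z' w v = s + l *\<^sub>R z w" using tan[OF b(1,3)] by blast
        have "n \<bullet> s = 0" "e \<bullet> s = 0" using s(1) n(2) e(2) by (auto intro: span_base)
        then show "- (n \<bullet> z w) * (inverse (e \<bullet> z w) * (e \<bullet> z' w v) * inverse (e \<bullet> z w)) +
            (n \<bullet> z' w v) / (e \<bullet> z w) = 0"
          using b(2) by (simp add: s(2) inner_add_right field_simps)
      qed
      finally show "((\<lambda>w. (n \<bullet> z w) / (e \<bullet> z w)) has_derivative (\<lambda>v. 0)) (at w within ball w1 \<delta>)"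
        by (rule has_derivative_at_withinI)
    qed simp
    then obtain c where c: "\<And>w. w \<in> ball w1 \<delta> \<Longrightarrow> (n \<bullet> z w) / (e \<bullet> z w) = c" by blast
    have "n \<bullet> z w1 = 0" using n(2) by (simp add: span_base)
    then have "(n \<bullet> z w) / (e \<bullet> z w) = 0"
      using c[OF w] c[of w1] \<open>0 < \<delta>\<close> by simp
    then show False using n(1) ball(2)[OF w] by simp
  qed
  then show ?thesis using that[OF \<open>0 < \<delta>\<close>] sub by blast
qed

text \<open>A ball whose image has a direction space of least dimension. Information about an
  arbitrarily small ball inside it then reaches the whole image.\<close>

lemma constant_directions_ball:
  fixes \<phi> :: "'b::real_normed_vector \<Rightarrow> 'a::euclidean_space"
  assumes "0 < \<epsilon>"
  obtains w0 \<delta> where "0 < \<delta>" "ball w0 \<delta> \<subseteq> ball 0 \<epsilon>"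
    "\<And>w \<eta>. 0 < \<eta> \<Longrightarrow> ball w \<eta> \<subseteq> ball w0 \<delta> \<Longrightarrow>
      directions (\<phi> ` ball w \<eta>) = directions (\<phi> ` ball w0 \<delta>)"
proof -
  define Pr where "Pr p \<longleftrightarrow> 0 < snd p \<and> ball (fst p) (snd p) \<subseteq> ball 0 \<epsilon>" for p :: "'b \<times> real"
  define f where "f p = dim (directions (\<phi> ` ball (fst p) (snd p)))" for p :: "'b \<times> real"
  have "Pr (0, \<epsilon>)" using assms by (simp add: Pr_def)
  then obtain p where p: "Pr p" "\<And>q. Pr q \<Longrightarrow> f p \<le> f q"
    using ex_has_least_nat[of Pr _ f] by blast
  show ?thesis
  proof (rule that[of "snd p" "fst p"])
    show "0 < snd p" "ball (fst p) (snd p) \<subseteq> ball 0 \<epsilon>" using p(1) by (auto simp: Pr_def)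
    fix w \<eta> assume *: "0 < \<eta>" "ball w \<eta> \<subseteq> ball (fst p) (snd p)"
    then have "f p \<le> f (w, \<eta>)" using p by (auto simp: Pr_def)
    then show "directions (\<phi> ` ball w \<eta>) = directions (\<phi> ` ball (fst p) (snd p))"
      using * by (intro subspace_dim_equal directions_mono)
        (auto simp: f_def directions_def)
  qed
qed

text \<open>The geometric half, free of algebra. \<open>m \<ge> 1\<close> makes the piece infinite,
  so that the auxiliary vertices of the approximation exist.\<close>

theorem neighborly_dimension_bound:
  fixes X :: "'a::euclidean_space set" and \<phi> :: "'b::euclidean_space \<Rightarrow> 'a"
  assumes dense: "\<And>n. \<exists>U \<subseteq> {x \<in> {..<n} \<rightarrow>\<^sub>E X. neighborly_set k (x ` {..<n})}.
      power_space n X closure_of U = topspace (power_space n X)"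
    and k: "k \<ge> 1" and m: "m \<ge> 1" and "0 < \<epsilon>"
    and der: "\<And>w. w \<in> ball 0 \<epsilon> \<Longrightarrow> (\<phi> has_derivative \<phi>' w) (at w)"
    and rank: "\<And>w. w \<in> ball 0 \<epsilon> \<Longrightarrow> m \<le> dim (range (\<phi>' w))"
    and opn: "\<And>w \<delta>. ball w \<delta> \<subseteq> ball 0 \<epsilon> \<Longrightarrow> openin (top_of_set X) (\<phi> ` ball w \<delta>)"
  shows "DIM('a) \<ge> 2 * k + m - 1"
proof -
  obtain w0 \<delta> where \<delta>: "0 < \<delta>" "ball w0 \<delta> \<subseteq> ball 0 \<epsilon>"
    and dirs: "\<And>w \<eta>. 0 < \<eta> \<Longrightarrow> ball w \<eta> \<subseteq> ball w0 \<delta> \<Longrightarrow>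
      directions (\<phi> ` ball w \<eta>) = directions (\<phi> ` ball w0 \<delta>)"
    by (rule constant_directions_ball[OF \<open>0 < \<epsilon>\<close>, of \<phi>]) (rule that)
  define A where "A = ball w0 \<delta>"
  define M where "M = \<phi> ` A"
  have A: "open A" "w0 \<in> A" "connected A" using \<delta>(1) by (auto simp: A_def)
  have derA: "(\<phi> has_derivative \<phi>' w) (at w)" "m \<le> dim (range (\<phi>' w))" if "w \<in> A" for w
    using that \<delta>(2) der rank by (auto simp: A_def)
  have contA: "continuous_on A \<phi>"
    using derA(1) by (meson continuous_at_imp_continuous_on has_derivative_continuous)
  have "infinite M"
  proof
    assume "finite M"
    moreover have "connected M" unfolding M_def using contA A(3) by (rule connected_continuous_image)
    moreover have "\<phi> w0 \<in> M" using A(2) by (simp add: M_def)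
    ultimately have "M = {\<phi> w0}" using connected_finite_iff_sing[of M] by auto
    then have "\<phi> w0 = \<phi> w" if "w \<in> A" for w
      using that unfolding M_def by (metis imageI singletonD)
    then have "(\<phi> has_derivative (\<lambda>_. 0)) (at w0)"
      using has_derivative_transform_within_open[OF has_derivative_const A(1,2)] by blast
    then have "\<phi>' w0 = (\<lambda>_. 0)" using derA(1)[OF A(2)] has_derivative_unique by blast
    then show False using derA(2)[OF A(2)] m by simp
  qed
  have openM: "openin (top_of_set X) M" unfolding M_def A_def by (rule opn[OF \<delta>(2)])
  \<comment> \<open>With the differences from \<open>\<phi> (p 0)\<close> adjoined to the tangent
    directions, this is the direction space of the affine span of the tangent spaces.\<close>
  define T where "T p j = span ((\<Union>i<j. range (\<phi>' (p i))) \<union> (\<lambda>i. \<phi> (p i) - \<phi> (p 0)) ` {..<j})"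
    for p and j :: nat
  have orth: "\<exists>u\<in>directions M. norm u = 1 \<and> (\<forall>s\<in>T p j. u \<bullet> s = 0)"
    if p: "\<And>i. i < j \<Longrightarrow> p i \<in> A" and j: "0 < j" "j \<le> k" for p j
  proof -
    \<comment> \<open>Supporting normals are available for lists of \<open>k\<close> points; a
      shorter list is filled up with \<open>p 0\<close>.\<close>
    define x where "x i = \<phi> (p (if i < j then i else 0))" for i
    have "x i \<in> M" for i using p j(1) by (auto simp: x_def M_def)
    then obtain u where u: "norm u = 1" "u \<in> directions M"
      and le: "\<And>i y. i < k \<Longrightarrow> y \<in> M \<Longrightarrow> u \<bullet> (y - x i) \<le> 0"
      using supporting_normal[OF dense openM \<open>infinite M\<close> k, of x] by blast
    have le: "u \<bullet> \<phi> w \<le> u \<bullet> \<phi> (p i)" if "i < j" "w \<in> A" for i w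
      using le[of i "\<phi> w"] that j(2) by (auto simp: x_def M_def inner_diff_right)
    \<comment> \<open>Each \<open>p i\<close> with \<open>i < j\<close> maximises
      \<open>u \<bullet> \<phi> w\<close> over the open set \<open>A\<close>: the derivative
      vanishes there, and the maximal values coincide.\<close>
    have "orthogonal u s" if "s \<in> T p j" for s
      using that unfolding T_def
    proof (rule orthogonal_to_span, elim UnE UN_E imageE)
      fix s i v assume i: "i \<in> {..<j}" and s: "s = \<phi>' (p i) v"
      have "((\<lambda>w. u \<bullet> \<phi> w) has_derivative (\<lambda>v. u \<bullet> \<phi>' (p i) v)) (at (p i))"
        using p i by (intro has_derivative_inner_right derA(1)) auto
      then have "(\<lambda>v. u \<bullet> \<phi>' (p i) v) = (\<lambda>v. 0)"
        using differential_zero_maxmin[of "p i" A "\<lambda>w. u \<bullet> \<phi> w"] p i A(1) le by auto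
      then show "orthogonal u s" unfolding s orthogonal_def by meson
    next
      fix s i assume i: "i \<in> {..<j}" and s: "s = \<phi> (p i) - \<phi> (p 0)"
      have "u \<bullet> \<phi> (p i) = u \<bullet> \<phi> (p 0)"
        using le[of i "p 0"] le[of 0 "p i"] p i j(1) by force
      then show "orthogonal u s" by (simp add: s orthogonal_def inner_diff_right)
    qed
    then show ?thesis using u by (auto simp: orthogonal_def)
  qed
  have grow: "\<exists>p. (\<forall>i<Suc l. p i \<in> A) \<and> m + 2 * l \<le> dim (T p (Suc l))" if "l < k" for l
    using that
  proof (induction l)
    case 0
    have "range (\<phi>' w0) \<subseteq> T (\<lambda>_. w0) 1" by (auto simp: T_def intro: span_base)
    then have "m \<le> dim (T (\<lambda>_. w0) 1)" using derA(2)[OF A(2)] dim_subset le_trans by blast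
    then show ?case using A(2) by (intro exI[of _ "\<lambda>_. w0"]) simp
  next
    case (Suc l)
    define j where "j = Suc l"
    obtain p where p: "\<And>i. i < j \<Longrightarrow> p i \<in> A" "m + 2 * l \<le> dim (T p j)"
      using Suc by (auto simp: j_def)
    have jk: "0 < j" "Suc j \<le> k" using Suc.prems by (auto simp: j_def)
    define S where "S = T p j"
    have S: "subspace S" "span S = S" by (auto simp: S_def T_def)
    define z where "z w = \<phi> w - \<phi> (p 0)" for w
    have ext: "S \<union> range (\<phi>' w) \<union> {z w} \<subseteq> T (p(j := w)) (Suc j)" for w
    proof -
      have "S \<subseteq> T (p(j := w)) (Suc j)"
        unfolding S_def T_def
      proof (intro span_mono Un_mono)
        show "(\<Union>i<j. range (\<phi>' (p i))) \<subseteq> (\<Union>i<Suc j. range (\<phi>' ((p(j := w)) i)))"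
          by (rule UN_mono) auto
        show "(\<lambda>i. \<phi> (p i) - \<phi> (p 0)) ` {..<j} \<subseteq>
            (\<lambda>i. \<phi> ((p(j := w)) i) - \<phi> ((p(j := w)) 0)) ` {..<Suc j}"
        proof (rule image_subsetI)
          fix i assume "i \<in> {..<j}"
          then show "\<phi> (p i) - \<phi> (p 0) \<in>
              (\<lambda>i. \<phi> ((p(j := w)) i) - \<phi> ((p(j := w)) 0)) ` {..<Suc j}"
            using jk(1) by (intro image_eqI[of _ _ i]) auto
        qed
      qed
      moreover have "\<phi>' w v \<in> T (p(j := w)) (Suc j)" for v
        unfolding T_def by (intro span_base UnI1 UN_I[of j]) auto
      moreover have "z w \<in> T (p(j := w)) (Suc j)"
        unfolding T_def by (intro span_base UnI2 image_eqI[of _ _ j]) (use jk(1) in \<open>auto simp: z_def\<close>)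
      ultimately show ?thesis by blast
    qed
    have ext_in: "(p(j := w)) i \<in> A" if "i < Suc j" "w \<in> A" for i w
      using that p(1) by (auto simp: less_Suc_eq)
    have "\<exists>p. (\<forall>i<Suc j. p i \<in> A) \<and> m + 2 * Suc l \<le> dim (T p (Suc j))" (is ?goal)
    proof (rule ccontr)
      assume neg: "\<not> ?goal"
      \<comment> \<open>If no extended list gains two dimensions, then for every \<open>w\<close>
        the new tangent directions and the new difference together add at most one to
        \<open>S\<close>.\<close>
      have small: "dim (S \<union> range (\<phi>' w) \<union> {z w}) \<le> Suc (dim S)" if w: "w \<in> A" for w
      proof (rule ccontr)
        assume "\<not> ?thesis"
        then have "m + 2 * Suc l \<le> dim (S \<union> range (\<phi>' w) \<union> {z w})" using p(2) by (simp add: S_def)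
        also have "\<dots> \<le> dim (T (p(j := w)) (Suc j))" by (rule dim_subset[OF ext])
        finally show False using neg ext_in w by blast
      qed
      \<comment> \<open>Otherwise \<open>directions M\<close> lies in \<open>S\<close>, and the
        normal for the \<open>j\<close> points found so far is orthogonal to itself.\<close>
      have "\<exists>w1\<in>A. z w1 \<notin> S"
      proof (rule ccontr)
        assume "\<not> ?thesis"
        then have "directions M \<subseteq> S"
          by (intro directions_subset[OF S(1), of _ "\<phi> (p 0)"]) (auto simp: M_def z_def)
        moreover obtain u where "u \<in> directions M" "norm u = 1" "\<forall>s\<in>S. u \<bullet> s = 0"
          using orth[of j p] p(1) jk by (auto simp: S_def)
        ultimately have "u \<bullet> u = 0" by blast
        then show False using \<open>norm u = 1\<close> by simp
      qed
      then obtain w1 where w1: "w1 \<in> A" "z w1 \<notin> S" by blast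
      have derz: "(z has_derivative \<phi>' w) (at w)" if "w \<in> A" for w
        unfolding z_def[abs_def] using has_derivative_diff[OF derA(1)[OF that] has_derivative_const] by simp
      \<comment> \<open>\<open>z w\<close> uses up the one additional dimension, so modulo
        \<open>S\<close> every velocity is a multiple of the position.\<close>
      have tan: "\<exists>s\<in>S. \<exists>c. \<phi>' w v = s + c *\<^sub>R z w" if w: "w \<in> A" "z w \<notin> S" for w v
      proof -
        have sub: "span (insert (z w) S) \<subseteq> span (S \<union> range (\<phi>' w) \<union> {z w})"
          by (intro span_mono) auto
        have "dim (span (insert (z w) S)) = Suc (dim S)"
          using w(2) by (simp add: dim_insert S(2))
        then have "span (insert (z w) S) = span (S \<union> range (\<phi>' w) \<union> {z w})"
          using subspace_dim_equal[OF subspace_span subspace_span sub] small[OF w(1)] by simp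
        then have "\<phi>' w v \<in> span (insert (z w) S)"
          by (auto intro: span_base)
        then obtain c where "\<phi>' w v - c *\<^sub>R z w \<in> S" using S(2) by (auto simp: span_insert)
        then show ?thesis by (intro bexI[of _ "\<phi>' w v - c *\<^sub>R z w"] exI[of _ c]) auto
      qed
      obtain \<eta> where \<eta>: "0 < \<eta>" "ball w1 \<eta> \<subseteq> A"
        "\<And>w. w \<in> ball w1 \<eta> \<Longrightarrow> z w \<in> span (insert (z w1) S)"
        using curve_stays_in_span[OF derz A(1) w1(1) S(1) w1(2) tan] by blast
      \<comment> \<open>The small ball has all directions of \<open>M\<close>, which therefore lie
        in the space for \<open>Suc j\<close> points; as \<open>Suc j \<le> k\<close>, these still
        admit a supporting normal.\<close>
      have "directions M = directions (\<phi> ` ball w1 \<eta>)"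
        using dirs[OF \<eta>(1)] \<eta>(2) by (simp add: M_def A_def)
      also have "\<dots> \<subseteq> span (insert (z w1) S)"
        by (rule directions_subset[of _ _ "\<phi> (p 0)"]) (use \<eta>(3) in \<open>auto simp: z_def\<close>)
      also have "\<dots> \<subseteq> T (p(j := w1)) (Suc j)"
        by (rule span_minimal) (use ext[of w1] in \<open>auto simp: T_def\<close>)
      finally have "directions M \<subseteq> T (p(j := w1)) (Suc j)" .
      moreover obtain u where "u \<in> directions M" "norm u = 1" "\<forall>s\<in>T (p(j := w1)) (Suc j). u \<bullet> s = 0"
        using orth[of "Suc j" "p(j := w1)"] ext_in w1(1) jk by auto
      ultimately have "u \<bullet> u = 0" by blast
      then show False using \<open>norm u = 1\<close> by simp
    qed
    then show ?case by (simp add: j_def)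
  qed
  obtain p where p: "\<And>i. i < k \<Longrightarrow> p i \<in> A" "m + 2 * (k - 1) \<le> dim (T p k)"
    using grow[of "k - 1"] k by auto
  obtain u where "norm u = 1" "\<forall>s\<in>T p k. u \<bullet> s = 0"
    using orth[of k p] p(1) k by auto
  then have "T p k \<subseteq> {x. u \<bullet> x = 0}" "u \<noteq> 0" by auto
  then have "dim (T p k) \<le> DIM('a) - 1"
    using dim_subset dim_hyperplane by metis
  moreover have "DIM('a) \<ge> 1" using DIM_positive[where 'a = 'a] by linarith
  ultimately show ?thesis using p(2) k by linarith
qed

theorem theorem4p15:
  fixes V :: "(real ^ 'p::finite) set" and k d :: nat
  assumes "k \<ge> 1" and "d \<ge> 1"
    and "generally_neighborly k V"
    and "variety_dim V = enat d"
  shows "CARD('p) \<ge> 2 * k + d - 1"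
proof -
  let ?X = "smooth_points V"
  have V: "real_variety V" "irreducible_set V" "?X \<noteq> {}"
    and dense: "\<And>n. \<exists>U \<subseteq> {x \<in> {..<n} \<rightarrow>\<^sub>E ?X. neighborly_set k (x ` {..<n})}.
      power_space n ?X closure_of U = topspace (power_space n ?X)"
    using assms(3) unfolding generally_neighborly_def neighborly_configs_def by blast+
  obtain x0 where sm: "x0 \<in> ?X" using V(3) by blast
  obtain B g P where "smooth_frame V x0 B g P" using smooth_frame_exists[OF sm] by blast
  then interpret smooth_frame V x0 B g P .
  have d: "d \<le> CARD('p) - card B" using variety_dim_le[OF V(2)] assms(4) by simp
  obtain \<epsilon> and \<phi> :: "real ^ 'p \<Rightarrow> real ^ 'p" and \<phi>' where "0 < \<epsilon>"
    "\<And>w. w \<in> ball 0 \<epsilon> \<Longrightarrow> (\<phi> has_derivative \<phi>' w) (at w)"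
    "\<And>w. w \<in> ball 0 \<epsilon> \<Longrightarrow> CARD('p) - card B \<le> dim (range (\<phi>' w))"
    "\<And>w \<delta>. ball w \<delta> \<subseteq> ball 0 \<epsilon> \<Longrightarrow> openin (top_of_set ?X) (\<phi> ` ball w \<delta>)"
    using chart[OF V(1) sm] by blast
  \<comment> \<open>The rank bound is \<open>m = CARD('p) - card B\<close>, which is at least
    \<open>d\<close> and hence positive.\<close>
  then have "DIM(real ^ 'p) \<ge> 2 * k + (CARD('p) - card B) - 1"
    using d assms(1,2) by (intro neighborly_dimension_bound[OF dense]) auto
  then show ?thesis using d by simp
qed

end
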